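(* Let $\Omega,\Omega^*\subseteq S^2$ with $|\partial\Omega|=0$ be such that, for some $0<\delta<1$, $x\cdot m\le 1-\delta$ for all $x\in\bar\Omega$, $m\in\bar\Omega^*$. Let $f\in L^1(\bar\Omega)$ with $f>0$ a.e., and let $\eta$ be a Radon measure on $\bar\Omega^*$. Let $a>0$ and $a'\ge\frac{4a}{\delta}$, and assume $$\int_{\bar\Omega}f(x)\,dx\ \ge\ \frac{1}{C(a',\delta)}\,\eta(\bar\Omega^* ),\qquad C(a',\delta)=\frac{\delta^3}{2a'^2}.$$ Then for every $m_0$ in the support of $\eta$ there exists a far field reflector $\sigma=\{\rho(x)x\}_{x\in\bar\Omega}$ from $\bar\Omega$ to $\bar\Omega^*$ such that $$\eta(E)\le\int_{\tau_\sigma(E)}f(x)\,\frac{x\cdot\nu_\rho(x)}{\rho(x)^2}\,dx\quad\text{for each Borel set }E\subseteq\bar\Omega^*,$$ $$\eta(E)=\int_{\tau_\sigma(E)}f(x)\,\frac{x\cdot\nu_\rho(x)}{\rho(x)^2}\,dx\quad\text{for each Borel set }E\subseteq\bar\Omega^*\text{ with }m_0\notin E.$$ In addition, $\sigma$ belongs to $\mathcal A(a)$, and $a\le\rho(x)\le\frac{a'}{\delta}$ for all $x\in\bar\Omega$.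
   Context: $S^2$ is the unit sphere of $\mathbb{R}^3$ centered at the origin $O$; $dx$ and $|\cdot|$ denote surface (Lebesgue) measure on $S^2$; bars and $\partial$ denote closure and boundary in $S^2$. For $m\in S^2$ and $d>0$, $P_d(m)$ is the paraboloid of revolution with focus $O$, axis direction $m$ and polar radius $\rho_d(x)=\frac{d}{1-x\cdot m}$, $x\in S^2\setminus\{m\}$. A surface $\sigma=\{\rho(x)x\}_{x\in\bar\Omega}$, $\rho>0$, is a (far field) reflector from $\bar\Omega$ to $\bar\Omega^*$ if for each $x_0\in\bar\Omega$ there is a paraboloid $P_d(m)$ with $m\in\bar\Omega^*$ that supports $\sigma$ at $\rho(x_0)x_0$, i.e. $\rho(x)\le\rho_d(x)$ for all $x\in\bar\Omega$ with equality at $x=x_0$. For $m\in\bar\Omega^*$, $\tau_\sigma(m)$ is the set of $x_0\in\bar\Omega$ such that some $P_d(m)$ supports $\sigma$ at $\rho(x_0)x_0$; $\tau_\sigma(E)=\bigcup_{m\in E}\tau_\sigma(m)$. For $a>0$, $\mathcal A(a)$ is the class of reflectors $\sigma$ from $\bar\Omega$ to $\bar\Omega^*$ such that for each $x_0\in\bar\Omega$ there is a supporting paraboloid $P_d(m)$ to $\sigma$ at $\rho(x_0)x_0$ with $m\in\bar\Omega^*$ and $d\ge 2a$. $\nu_\rho(x)$ is the outer unit normal to $\sigma$ at $\rho(x)x$ (defined for a.e. $x\in\bar\Omega$; a.e. it equals $\frac{x-m}{|x-m|}$ where $P_d(m)$ is the supporting paraboloid at that point). *)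

theory Defs
  imports "HOL-Analysis.Analysis"
begin

text \<open>Since the unit sphere is closed in the ambient space, the closure in the sphere of a
  subset of the sphere is its ambient \<^const>\<open>closure\<close>.\<close>

abbreviation S2 :: "(real^3) set" where
  "S2 \<equiv> sphere 0 1"

text \<open>Surface measure in polar coordinates: the area of a Borel set \<open>E\<close> of the sphere is three
  times the volume of the cone \<open>{t x | 0 < t \<le> 1, x \<in> E}\<close> over it. The completion makes the
  measurable sets the Lebesgue measurable subsets of the sphere.\<close>

definition surface_measure :: "(real^3) measure" where
  "surface_measure = completion (scale_measure 3
     (distr (restrict_space lborel (cball 0 1 - {0})) (restrict_space borel S2)
        (\<lambda>y. y /\<^sub>R norm y)))"

definition radon_measure_on :: "'a::topological_space set \<Rightarrow> 'a measure \<Rightarrow> bool" where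
  "radon_measure_on X \<eta> \<longleftrightarrow>
     sets \<eta> = sets (restrict_space borel X) \<and>
     (\<forall>K. compact K \<and> K \<subseteq> X \<longrightarrow> emeasure \<eta> K < \<infinity>) \<and>
     (\<forall>E\<in>sets \<eta>. emeasure \<eta> E = (INF U\<in>{U. openin (top_of_set X) U \<and> E \<subseteq> U}. emeasure \<eta> U)) \<and>
     (\<forall>U. openin (top_of_set X) U \<longrightarrow>
        emeasure \<eta> U = (SUP K\<in>{K. compact K \<and> K \<subseteq> U}. emeasure \<eta> K))"

definition support_on :: "'a::topological_space set \<Rightarrow> 'a measure \<Rightarrow> 'a set" where
  "support_on X \<eta> = {m \<in> X. \<forall>U. openin (top_of_set X) U \<and> m \<in> U \<longrightarrow> 0 < emeasure \<eta> U}"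

text \<open>Meaningful only for \<open>x \<noteq> m\<close>. The case \<open>x = m\<close> does not arise when \<open>closure \<Omega>\<close> and
  \<open>closure \<Omega>'\<close> are disjoint, where \<open>x\<close> and \<open>m\<close> range respectively.\<close>

definition polar_radius :: "real \<Rightarrow> real^3 \<Rightarrow> real^3 \<Rightarrow> real" where
  "polar_radius d m x = d / (1 - x \<bullet> m)"

text \<open>A surface \<open>{\<rho>(x) x | x \<in> closure \<Omega>}\<close> is represented by its radial function \<open>\<rho>\<close>, of which
  only the values on \<open>closure \<Omega>\<close> are relevant.\<close>

definition supports ::
  "(real^3) set \<Rightarrow> (real^3 \<Rightarrow> real) \<Rightarrow> real \<Rightarrow> real^3 \<Rightarrow> real^3 \<Rightarrow> bool" where
  "supports \<Omega> \<rho> d m x\<^sub>0 \<longleftrightarrow>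
     d > 0 \<and> (\<forall>x\<in>closure \<Omega>. \<rho> x \<le> polar_radius d m x) \<and> \<rho> x\<^sub>0 = polar_radius d m x\<^sub>0"

definition reflector :: "(real^3) set \<Rightarrow> (real^3) set \<Rightarrow> (real^3 \<Rightarrow> real) \<Rightarrow> bool" where
  "reflector \<Omega> \<Omega>' \<rho> \<longleftrightarrow>
     (\<forall>x\<in>closure \<Omega>. \<rho> x > 0) \<and>
     (\<forall>x\<^sub>0\<in>closure \<Omega>. \<exists>m\<in>closure \<Omega>'. \<exists>d. supports \<Omega> \<rho> d m x\<^sub>0)"

definition tau :: "(real^3) set \<Rightarrow> (real^3 \<Rightarrow> real) \<Rightarrow> real^3 \<Rightarrow> (real^3) set" where
  "tau \<Omega> \<rho> m = {x\<^sub>0 \<in> closure \<Omega>. \<exists>d. supports \<Omega> \<rho> d m x\<^sub>0}"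

definition tau_set :: "(real^3) set \<Rightarrow> (real^3 \<Rightarrow> real) \<Rightarrow> (real^3) set \<Rightarrow> (real^3) set" where
  "tau_set \<Omega> \<rho> E = (\<Union>m\<in>E. tau \<Omega> \<rho> m)"

definition reflector_class ::
  "(real^3) set \<Rightarrow> (real^3) set \<Rightarrow> real \<Rightarrow> (real^3 \<Rightarrow> real) set" where
  "reflector_class \<Omega> \<Omega>' a = {\<rho>. reflector \<Omega> \<Omega>' \<rho> \<and>
     (\<forall>x\<^sub>0\<in>closure \<Omega>. \<exists>m\<in>closure \<Omega>'. \<exists>d\<ge>2 * a. supports \<Omega> \<rho> d m x\<^sub>0)}"

text \<open>The unit vector orthogonal to the tangent plane of the surface at \<open>\<rho>(x) x\<close> and pointing away
  from the origin. The tangent plane is the image of the tangent plane of the sphere at \<open>x\<close> under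
  the derivative of \<open>y \<mapsto> \<rho>(y) y\<close>. The normal is uniquely determined when \<open>x\<close> is interior to
  \<open>closure \<Omega>\<close> in the sphere and \<open>\<rho>\<close> is positive and differentiable at \<open>x\<close>; elsewhere it may be
  unspecified.\<close>

definition outer_normal :: "(real^3) set \<Rightarrow> (real^3 \<Rightarrow> real) \<Rightarrow> real^3 \<Rightarrow> real^3" where
  "outer_normal \<Omega> \<rho> x = (THE \<nu>. norm \<nu> = 1 \<and> x \<bullet> \<nu> > 0 \<and>
     (\<exists>D. ((\<lambda>y. \<rho> y *\<^sub>R y) has_derivative D) (at x within closure \<Omega>) \<and>
          (\<forall>h. h \<bullet> x = 0 \<longrightarrow> D h \<bullet> \<nu> = 0)))"

definition refl_density ::
  "(real^3) set \<Rightarrow> (real^3 \<Rightarrow> real) \<Rightarrow> (real^3 \<Rightarrow> real) \<Rightarrow> real^3 \<Rightarrow> real" where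
  "refl_density \<Omega> f \<rho> x = f x * ((x \<bullet> outer_normal \<Omega> \<rho> x) / (\<rho> x)\<^sup>2)"

definition C_const :: "real \<Rightarrow> real \<Rightarrow> real" where
  "C_const a' \<delta> = \<delta>^3 / (2 * a'\<^sup>2)"

end

theory Submission imports Defs "HOL-Complex_Analysis.Great_Picard" begin

text \<open>At a point \<open>x\<close> touched by a single paraboloid, with axis direction \<open>m\<close>, the density is
  \<open>f x * sqrt ((1 - x \<bullet> m) / 2) / (\<rho> x)\<^sup>2\<close>, and almost every point is of this kind because
  \<open>1 / \<rho>\<close> extends to a 1-homogeneous convex function on the whole space. Touching directions converge
  along pointwise convergent radial functions wherever the limit direction is unique, so by dominated
  convergence the transported measure depends continuously on \<open>\<rho>\<close>. When \<open>\<eta>\<close> is replaced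
  by a finite combination of point masses including \<open>m\<^sub>0\<close>, one fixes the polar radius of \<open>m\<^sub>0\<close> to be
  \<open>a'\<close> and minimises the sum of the others, subject to no other direction receiving more than its
  share; at the minimum they receive exactly their share, since otherwise some radius could be
  decreased further, and by the mass condition \<open>m\<^sub>0\<close> receives at least its own.
  The Arzela-Ascoli theorem then passes to general \<open>\<eta>\<close>, with the excess concentrated at \<open>m\<^sub>0\<close>.\<close>

section \<open>Uniqueness of subgradients\<close>

text \<open>The constant C(a', \<delta>) is a lower bound for the weight multiplying f. Keeping the
  polar parameter of \<open>m0\<close> at a' forces \<rho> \<le> a'/\<delta> whatever the other
  parameters are, and the weight is then at least (\<delta>/2) / (a'/\<delta>)^2 = \<delta>^3 / (2
  a'^2). So every surface in the minimisation transports at least the total mass of \<eta>.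
  Membership of \<open>m0\<close> in the support supplies the lower bounds. If another parameter
  fell below \<delta> a'/2, its paraboloid would lie strictly inside that of \<open>m0\<close>; then
  \<open>m0\<close> would receive nothing, and the others, capped at their shares, could not absorb
  the total, since the share of \<open>m0\<close> is positive. The bound d \<ge> \<delta> a'/2
  survives the limit, and a' \<ge> 4a/\<delta> turns it into d \<ge> 2a. The recurring obstacle is
  that several directions may touch at one point. There the selected direction is arbitrary, and the
  normal is identified only where the direction is unique and the point is interior to the closure;
  identities of integrands are therefore stated almost everywhere.\<close>

definition subgradient :: "('a::euclidean_space \<Rightarrow> real) \<Rightarrow> 'a \<Rightarrow> 'a \<Rightarrow> bool" where
  "subgradient U y p \<longleftrightarrow> (\<forall>z. U y + p \<bullet> (z - y) \<le> U z)"

text \<open>Adding the support inequalities at t < t' shows that any slope at t is at most any slope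
  at t'. The open intervals between two slopes at different points are therefore disjoint and
  ordered, and a rational picked in each labels the points injectively.\<close>

lemma countable_multiple_slopes:
  fixes \<phi> :: "real \<Rightarrow> real"
  shows "countable {t. \<exists>p q. p < q \<and> (\<forall>s. \<phi> t + p * (s - t) \<le> \<phi> s) \<and> (\<forall>s. \<phi> t + q * (s - t) \<le> \<phi> s)}"
    (is "countable ?S")
proof -
  have "\<forall>t\<in>?S. \<exists>r::rat. \<exists>p q. p < real_of_rat r \<and> real_of_rat r < q
      \<and> (\<forall>s. \<phi> t + p * (s - t) \<le> \<phi> s) \<and> (\<forall>s. \<phi> t + q * (s - t) \<le> \<phi> s)"
    using of_rat_dense by blast
  from bchoice[OF this] obtain r :: "real \<Rightarrow> rat" where r: "\<And>t. t \<in> ?S \<Longrightarrow> \<exists>p q. p < real_of_rat (r t) \<and> real_of_rat (r t) < q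
      \<and> (\<forall>s. \<phi> t + p * (s - t) \<le> \<phi> s) \<and> (\<forall>s. \<phi> t + q * (s - t) \<le> \<phi> s)"
    by blast
  have less: "r t < r t'" if t: "t \<in> ?S" "t' \<in> ?S" "t < t'" for t t'
  proof -
    obtain q where q: "real_of_rat (r t) < q" "\<forall>s. \<phi> t + q * (s - t) \<le> \<phi> s"
      using r[OF t(1)] by blast
    obtain p where p: "p < real_of_rat (r t')" "\<forall>s. \<phi> t' + p * (s - t') \<le> \<phi> s"
      using r[OF t(2)] by blast
    have "q * (t' - t) \<le> p * (t' - t)"
      using q(2)[rule_format, of t'] p(2)[rule_format, of t] by (simp add: algebra_simps)
    hence "q \<le> p" using t(3) by simp
    thus ?thesis using p(1) q(1) by (smt (verit) of_rat_less)
  qed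
  have "inj_on r ?S"
  proof (rule inj_onI)
    fix t t' assume *: "t \<in> ?S" "t' \<in> ?S" "r t = r t'"
    show "t = t'"
      using less[OF *(1,2)] less[OF *(2,1)] *(3) by (metis linorder_neqE_linordered_idom order_less_irrefl)
  qed
  thus ?thesis by (rule countableI')
qed

text \<open>Averaging over the translates of A by -t e, for t in [0,1], leaves the volume unchanged;
  exchanging the integrals makes the inner one run along a line parallel to e, where A is countable.
  This avoids coordinates adapted to e.\<close>

lemma null_set_if_countable_on_lines:
  fixes e :: "'a::euclidean_space"
  assumes A: "A \<in> sets borel" and lines: "\<And>y. countable {t::real. y + t *\<^sub>R e \<in> A}"
  shows "A \<in> null_sets lborel"
proof -
  have [measurable]: "A \<in> sets borel" by fact
  let ?f = "\<lambda>(t::real) y::'a. indicator {0..1} t * indicator A (y + t *\<^sub>R e) :: ennreal"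
  have shift: "(\<integral>\<^sup>+ y. indicator A (y + c) \<partial>lborel) = emeasure lborel A" for c
  proof -
    have "(\<integral>\<^sup>+ y. indicator A (y + c) \<partial>lborel) = (\<integral>\<^sup>+ y. indicator A y \<partial>distr lborel borel (\<lambda>y. c + y))"
      by (subst nn_integral_distr) (auto simp: add.commute)
    also have "\<dots> = emeasure lborel A"
      by (simp add: lborel_distr_plus)
    finally show ?thesis .
  qed
  have "emeasure lborel A = (\<integral>\<^sup>+ t. indicator {0..1::real} t * emeasure lborel A \<partial>lborel)"
    by (subst nn_integral_multc) auto
  also have "\<dots> = (\<integral>\<^sup>+ t. \<integral>\<^sup>+ y. ?f t y \<partial>lborel \<partial>lborel)"
    by (subst nn_integral_cmult) (auto simp: shift)
  also have "\<dots> = (\<integral>\<^sup>+ y. \<integral>\<^sup>+ t. ?f t y \<partial>lborel \<partial>lborel)"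
    by (rule lborel_pair.Fubini'[symmetric]) measurable
  also have "\<dots> = (\<integral>\<^sup>+ (y::'a). 0 \<partial>lborel)"
  proof (rule nn_integral_cong)
    fix y :: 'a
    have "AE t in lborel. t \<notin> {t::real. y + t *\<^sub>R e \<in> A}"
      by (rule AE_not_in[OF countable_imp_null_set_lborel[OF lines]])
    hence "AE t in lborel. ?f t y = 0" by eventually_elim (auto simp: indicator_def)
    thus "(\<integral>\<^sup>+ t. ?f t y \<partial>lborel) = 0"
      by (subst nn_integral_0_iff_AE) auto
  qed
  finally show ?thesis using A by auto
qed

text \<open>Testing the subgradient inequality at y + p gives |p|^2 \<le> L |p|. The bound confines
  subgradients to a compact ball, from which limits can be extracted.\<close>

lemma subgradient_norm_le:
  assumes L: "\<And>y z. \<bar>U y - U z\<bar> \<le> L * norm (y - z)" and p: "subgradient U y p"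
  shows "norm p \<le> L"
proof (cases "p = 0")
  case True
  obtain b :: 'a where "b \<in> Basis" using nonempty_Basis by blast
  hence "0 \<le> L" using L[of b 0] abs_ge_zero[of "U b - U 0"] by simp
  thus ?thesis using True by simp
next
  case False
  have "U y + p \<bullet> p \<le> U (y + p)" using p unfolding subgradient_def by (metis add_diff_cancel_left')
  hence "norm p * norm p \<le> L * norm p"
    using L[of "y + p" y] by (simp add: dot_square_norm power2_eq_square)
  thus ?thesis using False by simp
qed

text \<open>Both subgradients stay in a ball and pass to the limit. Two merely distinct subgradients
  could merge there; a fixed gap r < s between their components persists, which is why the set is
  cut up by gaps. Closedness gives the Borel measurability needed for exchanging integrals.\<close>

lemma closed_subgradient_gap:
  fixes U :: "'a::euclidean_space \<Rightarrow> real"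
  assumes L: "\<And>y z. \<bar>U y - U z\<bar> \<le> L * norm (y - z)"
  shows "closed {y. \<exists>p q. subgradient U y p \<and> subgradient U y q \<and> p \<bullet> e \<le> r \<and> s \<le> q \<bullet> e}" (is "closed ?C")
  unfolding closed_sequential_limits
proof (intro allI impI, elim conjE)
  fix y l assume y: "\<forall>n. y n \<in> ?C" and lim: "y \<longlonglongrightarrow> l"
  have "L-lipschitz_on UNIV U"
  proof (rule lipschitz_onI)
    obtain b :: 'a where "b \<in> Basis" using nonempty_Basis by blast
    thus "0 \<le> L" using L[of b 0] abs_ge_zero[of "U b - U 0"] by simp
  qed (use L in \<open>auto simp: dist_norm\<close>)
  hence cont: "isCont U x" for x
    using lipschitz_on_continuous_on continuous_on_eq_continuous_at open_UNIV by blast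
  from y obtain p q where pq: "\<And>n. subgradient U (y n) (p n)" "\<And>n. subgradient U (y n) (q n)"
    "\<And>n. p n \<bullet> e \<le> r" "\<And>n. s \<le> q n \<bullet> e" by simp metis
  have "\<forall>n. (p n, q n) \<in> cball 0 L \<times> cball 0 L"
    using subgradient_norm_le[OF L pq(1)] subgradient_norm_le[OF L pq(2)] by simp
  moreover have "compact (cball (0::'a) L \<times> cball (0::'a) L)" by (intro compact_Times compact_cball)
  ultimately obtain P k where k: "strict_mono (k :: nat \<Rightarrow> nat)" and P: "((\<lambda>n. (p n, q n)) \<circ> k) \<longlonglongrightarrow> P"
    unfolding compact_def by meson
  have p': "(\<lambda>n. p (k n)) \<longlonglongrightarrow> fst P" and q': "(\<lambda>n. q (k n)) \<longlonglongrightarrow> snd P"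
    using tendsto_fst[OF P] tendsto_snd[OF P] by (simp_all add: o_def)
  have y': "(\<lambda>n. y (k n)) \<longlonglongrightarrow> l" using LIMSEQ_subseq_LIMSEQ[OF lim k] by (simp add: o_def)
  have Uy': "(\<lambda>n. U (y (k n))) \<longlonglongrightarrow> U l" using isCont_tendsto_compose[OF cont y'] .
  have *: "subgradient U l g" if "\<And>n. subgradient U (y n) (h n)" "(\<lambda>n. h (k n)) \<longlonglongrightarrow> g" for h g
    unfolding subgradient_def
  proof
    fix z
    have "(\<lambda>n. U (y (k n)) + h (k n) \<bullet> (z - y (k n))) \<longlonglongrightarrow> U l + g \<bullet> (z - l)"
      by (intro tendsto_intros that y' Uy')
    thus "U l + g \<bullet> (z - l) \<le> U z"
      by (rule LIMSEQ_le_const2) (use that(1) in \<open>auto simp: subgradient_def\<close>)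
  qed
  have "subgradient U l (fst P)" "subgradient U l (snd P)"
    using *[OF pq(1) p'] *[OF pq(2) q'] by auto
  moreover have "fst P \<bullet> e \<le> r"
    by (rule LIMSEQ_le_const2[OF tendsto_inner[OF p' tendsto_const]]) (use pq in auto)
  moreover have "s \<le> snd P \<bullet> e"
    by (rule LIMSEQ_le_const[OF tendsto_inner[OF q' tendsto_const]]) (use pq in auto)
  ultimately show "l \<in> ?C" by blast
qed

text \<open>Distinct subgradients differ in some coordinate e, with rationals r < s between the two
  components. For fixed e, r, s the set is closed, and on each line parallel to e its points carry
  two distinct slopes, so there are countably many of them.\<close>

lemma null_set_multiple_subgradients:
  fixes U :: "'a::euclidean_space \<Rightarrow> real"
  assumes L: "\<And>y z. \<bar>U y - U z\<bar> \<le> L * norm (y - z)"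
  shows "{y. \<exists>p q. p \<noteq> q \<and> subgradient U y p \<and> subgradient U y q} \<in> null_sets lborel"
proof -
  define C where "C e r s = {y. \<exists>p q. subgradient U y p \<and> subgradient U y q \<and> p \<bullet> e \<le> r \<and> s \<le> q \<bullet> e}" 
    for e :: 'a and r s :: real
  let ?Q = "{(r, s). r \<in> \<rat> \<and> s \<in> \<rat> \<and> r < (s::real)}"
  have "countable ?Q"
    by (rule countable_subset[of _ "\<rat> \<times> \<rat>"]) (auto intro: countable_rat)
  have C_null: "C e r s \<in> null_sets lborel" if "r < s" for e r s
  proof (rule null_set_if_countable_on_lines[where e=e])
    show "C e r s \<in> sets borel"
      unfolding C_def by (intro borel_closed closed_subgradient_gap[OF L])
    fix y
    have "{t. y + t *\<^sub>R e \<in> C e r s} \<subseteq> {t. \<exists>p q. p < q \<and> (\<forall>s. U (y + t *\<^sub>R e) + p * (s - t) \<le> U (y + s *\<^sub>R e))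
        \<and> (\<forall>s. U (y + t *\<^sub>R e) + q * (s - t) \<le> U (y + s *\<^sub>R e))}"
    proof safe
      fix t assume "y + t *\<^sub>R e \<in> C e r s"
      then obtain p q where pq: "subgradient U (y + t *\<^sub>R e) p" "subgradient U (y + t *\<^sub>R e) q" "p \<bullet> e \<le> r" "s \<le> q \<bullet> e"
        unfolding C_def by blast
      have *: "U (y + t *\<^sub>R e) + (p \<bullet> e) * (u - t) \<le> U (y + u *\<^sub>R e)" if "subgradient U (y + t *\<^sub>R e) p" for p u
        using that[unfolded subgradient_def, rule_format, of "y + u *\<^sub>R e"]
        by (simp add: inner_diff_right inner_add_right algebra_simps)
      show "\<exists>p q. p < q \<and> (\<forall>s. U (y + t *\<^sub>R e) + p * (s - t) \<le> U (y + s *\<^sub>R e))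
        \<and> (\<forall>s. U (y + t *\<^sub>R e) + q * (s - t) \<le> U (y + s *\<^sub>R e))"
        using *[OF pq(1)] *[OF pq(2)] pq(3,4) that by (intro exI[of _ "p \<bullet> e"] exI[of _ "q \<bullet> e"]) auto
    qed
    thus "countable {t. y + t *\<^sub>R e \<in> C e r s}"
      by (rule countable_subset) (rule countable_multiple_slopes)
  qed
  have "{y. \<exists>p q. p \<noteq> q \<and> subgradient U y p \<and> subgradient U y q} = (\<Union>e\<in>Basis. \<Union>(r,s)\<in>?Q. C e r s)"
  proof (intro set_eqI iffI)
    fix y assume "y \<in> {y. \<exists>p q. p \<noteq> q \<and> subgradient U y p \<and> subgradient U y q}"
    then obtain p q where pq: "p \<noteq> q" "subgradient U y p" "subgradient U y q" by blast
    then obtain e where e: "e \<in> Basis" "p \<bullet> e \<noteq> q \<bullet> e" using euclidean_eq_iff by blast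
    have *: "\<exists>r s. r \<in> \<rat> \<and> s \<in> \<rat> \<and> r < s \<and> u \<le> r \<and> s \<le> v" if "u < v" for u v :: real
    proof -
      obtain r where r: "r \<in> \<rat>" "u < r" "r < v" using Rats_dense_in_real \<open>u < v\<close> by blast
      obtain s where s: "s \<in> \<rat>" "r < s" "s < v" using Rats_dense_in_real \<open>r < v\<close> by blast
      show ?thesis using r s by (intro exI[of _ r] exI[of _ s]) auto
    qed
    show "y \<in> (\<Union>e\<in>Basis. \<Union>(r,s)\<in>?Q. C e r s)"
    proof (cases "p \<bullet> e < q \<bullet> e")
      case True thus ?thesis using *[OF True] e pq unfolding C_def by blast
    next
      case False
      hence "q \<bullet> e < p \<bullet> e" using e by simp
      from *[OF this] show ?thesis using e pq unfolding C_def by blast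
    qed
  next
    fix y assume "y \<in> (\<Union>e\<in>Basis. \<Union>(r,s)\<in>?Q. C e r s)"
    then obtain e r s p q where "r < s" "subgradient U y p" "subgradient U y q" "p \<bullet> e \<le> r" "s \<le> q \<bullet> e"
      unfolding C_def by blast
    moreover from this have "p \<noteq> q" by auto
    ultimately show "y \<in> {y. \<exists>p q. p \<noteq> q \<and> subgradient U y p \<and> subgradient U y q}" by blast
  qed
  also have "\<dots> \<in> null_sets lborel"
    using \<open>countable ?Q\<close> by (intro null_sets_UN' ) (auto intro: C_null countable_finite)
  finally show ?thesis .
qed

section \<open>Touching directions\<close>

lemma sets_surface_measureI:
  assumes "B \<in> sets borel" shows "B \<inter> S2 \<in> sets surface_measure"
  unfolding surface_measure_def
  by (rule sets_completionI_sets) (use assms in \<open>auto simp: sets_restrict_space\<close>)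

lemma space_surface_measure [simp]: "space surface_measure = S2"
  unfolding surface_measure_def by (simp add: space_restrict_space space_scale_measure)

lemma complete_surface_measure: "complete_measure surface_measure"
  unfolding surface_measure_def by (rule completion.complete_measure_axioms)

text \<open>The surface measure is three times the volume of the cone in the unit ball, so it
  suffices that the cone over \<open>B \<inter> S2\<close> lies in the null set B, which is what
  \<open>cone\<close> provides.\<close>

lemma null_sets_surface_measure_cone:
  assumes B: "B \<in> null_sets lborel" and cone: "\<And>y. y \<noteq> 0 \<Longrightarrow> y /\<^sub>R norm y \<in> B \<Longrightarrow> y \<in> B"
  shows "B \<inter> S2 \<in> null_sets surface_measure"
proof -
  have [measurable]: "B \<in> sets borel" using B by auto
  let ?R = "restrict_space lborel (cball 0 1 - {0}) :: (real^3) measure"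
  let ?p = "\<lambda>y::real^3. y /\<^sub>R norm y"
  have p: "?p \<in> ?R \<rightarrow>\<^sub>M restrict_space borel S2"
  proof (rule measurable_restrict_space2)
    show "?p \<in> space ?R \<rightarrow> S2" by (auto simp: space_restrict_space)
    show "?p \<in> ?R \<rightarrow>\<^sub>M borel" by (rule measurable_restrict_space1) measurable
  qed
  have BS: "B \<inter> S2 \<in> sets (restrict_space borel S2)" by (auto simp: sets_restrict_space)
  have "emeasure (distr ?R (restrict_space borel S2) ?p) (B \<inter> S2) = emeasure ?R (?p -` (B \<inter> S2) \<inter> space ?R)"
    by (rule emeasure_distr[OF p BS])
  also have "\<dots> = emeasure lborel (?p -` (B \<inter> S2) \<inter> space ?R)"
    by (subst emeasure_restrict_space) (auto simp: space_restrict_space)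
  also have "\<dots> \<le> emeasure lborel B"
    by (rule emeasure_mono) (use cone in \<open>auto simp: space_restrict_space\<close>)
  also have "\<dots> = 0" using B by auto
  finally have "B \<inter> S2 \<in> null_sets (scale_measure 3 (distr ?R (restrict_space borel S2) ?p))"
    using BS by (auto simp: null_sets_def)
  thus ?thesis
    unfolding surface_measure_def by (rule null_sets_completionI)
qed

text \<open>Preimages within R are relatively Borel by continuity; those within the rest of K are
  subsets of a null set, hence measurable by completeness. The indicator sets the value outside K to
  0.\<close>

lemma surface_measurable_if_continuous_on:
  fixes g :: "real^3 \<Rightarrow> 'b::real_normed_vector"
  assumes R: "R \<subseteq> K" "K - R \<in> null_sets surface_measure" and K: "K \<in> sets surface_measure"
    and g: "continuous_on R g"
  shows "(\<lambda>x. indicator K x *\<^sub>R g x) \<in> borel_measurable surface_measure"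
proof -
  interpret complete_measure surface_measure by (rule complete_surface_measure)
  have KS: "K \<subseteq> S2" using sets.sets_into_space[OF K] by simp
  have Rm: "R \<in> sets surface_measure"
  proof -
    have "K - (K - R) \<in> sets surface_measure" by (rule sets.Diff[OF K null_setsD2[OF R(2)]])
    moreover have "K - (K - R) = R" using R by auto
    ultimately show ?thesis by (simp only:)
  qed
  show ?thesis
  proof (rule measurableI)
    fix A :: "'b set" assume A: "A \<in> sets borel"
    have "g -` A \<inter> R \<in> sets (restrict_space borel R)"
      using measurable_sets[OF borel_measurable_continuous_on_restrict[OF g] A]
      by (simp add: space_restrict_space)
    then obtain B where B: "B \<in> sets borel" "g -` A \<inter> R = R \<inter> B"
      by (auto simp: sets_restrict_space)
    have "R \<inter> B = R \<inter> (B \<inter> S2)" using R KS by auto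
    hence 1: "g -` A \<inter> R \<in> sets surface_measure"
      using B Rm sets_surface_measureI[OF B(1)] by auto
    have 2: "g -` A \<inter> (K - R) \<in> sets surface_measure"
      using complete2[of "g -` A \<inter> (K - R)", OF _ R(2)] by auto
    have 3: "(if 0 \<in> A then S2 - K else {}) \<in> sets surface_measure"
      using sets.compl_sets[OF K] by simp
    have "(\<lambda>x. indicator K x *\<^sub>R g x) -` A \<inter> space surface_measure
       = (g -` A \<inter> R) \<union> (g -` A \<inter> (K - R)) \<union> (if 0 \<in> A then S2 - K else {})"
    proof (intro set_eqI)
      fix x
      show "x \<in> (\<lambda>x. indicator K x *\<^sub>R g x) -` A \<inter> space surface_measure
        \<longleftrightarrow> x \<in> (g -` A \<inter> R) \<union> (g -` A \<inter> (K - R)) \<union> (if 0 \<in> A then S2 - K else {})"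
        using R(1) KS by (cases "x \<in> K") auto
    qed
    thus "(\<lambda>x. indicator K x *\<^sub>R g x) -` A \<inter> space surface_measure \<in> sets surface_measure"
      using 1 2 3 by auto
  qed auto
qed

text \<open>The paraboloid with axis m through \<rho>(x) x has parameter d = \<rho>(x) (1 - x
  \<bullet> m). Where 1 - y \<bullet> m is positive, clearing denominators shows that it supports
  the surface exactly when this product is maximal at x. The form contains neither d nor a division,
  so it passes to limits directly.\<close>

definition touches :: "'a::real_inner set \<Rightarrow> ('a \<Rightarrow> real) \<Rightarrow> 'a \<Rightarrow> 'a \<Rightarrow> bool" where
  "touches K \<rho> m x \<longleftrightarrow> (\<forall>y\<in>K. \<rho> y * (1 - y \<bullet> m) \<le> \<rho> x * (1 - x \<bullet> m))"

section \<open>Radial functions touched by a paraboloid at every point\<close>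

locale separated_directions =
  fixes K K' :: "(real^3) set" and \<delta> :: real
  assumes compact_K: "compact K" and K_subset: "K \<subseteq> S2"
    and compact_K': "compact K'" and K'_subset: "K' \<subseteq> S2"
    and \<delta>_pos: "0 < \<delta>" and separated: "\<And>x m. x \<in> K \<Longrightarrow> m \<in> K' \<Longrightarrow> x \<bullet> m \<le> 1 - \<delta>"
begin

definition admissible :: "real \<Rightarrow> real \<Rightarrow> (real^3 \<Rightarrow> real) \<Rightarrow> bool" where
  "admissible lo hi \<rho> \<longleftrightarrow> (\<forall>x\<in>K. lo \<le> \<rho> x \<and> \<rho> x \<le> hi) \<and> (\<forall>x\<in>K. \<exists>m\<in>K'. touches K \<rho> m x)"

definition single_dir :: "(real^3 \<Rightarrow> real) \<Rightarrow> real^3 \<Rightarrow> bool" where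
  "single_dir \<rho> x \<longleftrightarrow> (\<forall>m\<in>K'. \<forall>m'\<in>K'. touches K \<rho> m x \<longrightarrow> touches K \<rho> m' x \<longrightarrow> m = m')"

text \<open>A selection, arbitrary where several directions touch. For admissible \<rho> with
  positive lower bound such points form a null set, so integrals do not depend on the
  choice.\<close>

definition dir :: "(real^3 \<Rightarrow> real) \<Rightarrow> real^3 \<Rightarrow> real^3" where
  "dir \<rho> x = (SOME m. m \<in> K' \<and> touches K \<rho> m x)"

lemma norm_K: "x \<in> K \<Longrightarrow> norm x = 1" and norm_K': "m \<in> K' \<Longrightarrow> norm m = 1"
  using K_subset K'_subset by auto

lemma one_minus_ge: "x \<in> K \<Longrightarrow> m \<in> K' \<Longrightarrow> \<delta> \<le> 1 - x \<bullet> m"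
  using separated[of x m] by simp

lemma one_minus_le: "x \<in> K \<Longrightarrow> m \<in> K' \<Longrightarrow> 1 - x \<bullet> m \<le> 2"
  using Cauchy_Schwarz_ineq2[of x m] norm_K[of x] norm_K'[of m] by auto

lemma dir_props:
  assumes "admissible lo hi \<rho>" "x \<in> K"
  shows "dir \<rho> x \<in> K'" "touches K \<rho> (dir \<rho> x) x"
proof -
  have "\<exists>m. m \<in> K' \<and> touches K \<rho> m x" using assms unfolding admissible_def by blast
  from someI_ex[OF this] show "dir \<rho> x \<in> K'" "touches K \<rho> (dir \<rho> x) x"
    unfolding dir_def by auto
qed

lemma dir_eqI:
  assumes "admissible lo hi \<rho>" "x \<in> K" "single_dir \<rho> x" "m \<in> K'" "touches K \<rho> m x"
  shows "dir \<rho> x = m"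
  using dir_props[OF assms(1,2)] assms unfolding single_dir_def by blast

text \<open>A direction touching at x bounds \<rho> y - \<rho> x from above, and exchanging x and y
  gives the other side. The constant depends only on \<open>hi\<close> and \<delta>, which makes
  families with a common upper bound equicontinuous.\<close>

lemma admissible_lipschitz:
  assumes adm: "admissible lo hi \<rho>" and lo: "0 < lo" and xy: "x \<in> K" "y \<in> K"
  shows "\<bar>\<rho> x - \<rho> y\<bar> \<le> hi / \<delta> * norm (x - y)"
proof -
  have *: "\<rho> y - \<rho> x \<le> hi / \<delta> * norm (x - y)" if xy: "x \<in> K" "y \<in> K" for x y
  proof -
    obtain m where m: "m \<in> K'" "touches K \<rho> m x" using adm xy unfolding admissible_def by blast
    have \<rho>x: "0 \<le> \<rho> x" "\<rho> x \<le> hi" using adm lo xy(1) unfolding admissible_def by (smt (verit))+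
    have "\<rho> y * (1 - y \<bullet> m) \<le> \<rho> x * (1 - x \<bullet> m)" using m xy unfolding touches_def by blast
    hence 1: "(\<rho> y - \<rho> x) * (1 - y \<bullet> m) \<le> \<rho> x * ((y - x) \<bullet> m)" by (simp add: algebra_simps inner_diff_left)
    have "(y - x) \<bullet> m \<le> norm (x - y)"
      using norm_cauchy_schwarz[of "y - x" m] norm_K'[OF m(1)] by (simp add: norm_minus_commute)
    hence 2: "\<rho> x * ((y - x) \<bullet> m) \<le> hi * norm (x - y)"
      using \<rho>x by (meson mult_left_mono mult_right_mono norm_ge_zero order_trans)
    show ?thesis
    proof (cases "\<rho> y - \<rho> x \<le> 0")
      case True
      moreover have "0 \<le> hi / \<delta> * norm (x - y)" using \<rho>x \<delta>_pos by simp
      ultimately show ?thesis by linarith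
    next
      case False
      hence "(\<rho> y - \<rho> x) * \<delta> \<le> (\<rho> y - \<rho> x) * (1 - y \<bullet> m)"
        using one_minus_ge[OF xy(2) m(1)] by (intro mult_left_mono) auto
      hence "(\<rho> y - \<rho> x) * \<delta> \<le> hi * norm (x - y)" using 1 2 by linarith
      thus ?thesis using \<delta>_pos by (simp add: field_simps)
    qed
  qed
  show ?thesis using *[OF xy] *[OF xy(2,1)] by (simp add: norm_minus_commute abs_le_iff)
qed

lemma admissible_continuous:
  assumes adm: "admissible lo hi \<rho>" and lo: "0 < lo"
  shows "continuous_on K \<rho>"
proof (cases "K = {}")
  case False
  then obtain x0 where "x0 \<in> K" by blast
  hence "0 \<le> hi" using adm lo unfolding admissible_def by (smt (verit))
  hence "(hi / \<delta>)-lipschitz_on K \<rho>"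
    using admissible_lipschitz[OF adm lo] \<delta>_pos by (intro lipschitz_onI) (auto simp: dist_norm)
  thus ?thesis by (rule lipschitz_on_continuous_on)
qed auto

text \<open>The supremum of the homogeneous extensions \<open>(norm y - y \<bullet> m) / d\<close> of the reciprocal polar radii
  of the touching paraboloids extends \<open>1 / \<rho>\<close>, and distinct touching directions
  give distinct subgradients of it.\<close>

lemma null_set_not_single_dir:
  assumes adm: "admissible lo hi \<rho>" and lo: "0 < lo"
  shows "{x \<in> K. \<not> single_dir \<rho> x} \<in> null_sets surface_measure"
proof (cases "K = {}")
  case False
  define P where "P = {(m, x0). m \<in> K' \<and> x0 \<in> K \<and> touches K \<rho> m x0}"
  define D where "D = (\<lambda>(m, x0). \<rho> x0 * (1 - x0 \<bullet> m))"
  define v where "v i y = (norm y - y \<bullet> fst i) / D i" for i :: "(real^3) \<times> (real^3)" and y :: "real^3"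
  define U where "U y = (SUP i\<in>P. v i y)" for y
  define c where "c = lo * \<delta>"
  have c: "0 < c" using lo \<delta>_pos c_def by simp
  have \<rho>: "0 < \<rho> x" if "x \<in> K" for x using adm lo that unfolding admissible_def by (smt (verit))
  have P_ne: "P \<noteq> {}" using adm False unfolding admissible_def P_def by blast
  have D: "c \<le> D i" if "i \<in> P" for i
  proof -
    obtain m x0 where i: "i = (m, x0)" "m \<in> K'" "x0 \<in> K" using \<open>i \<in> P\<close> unfolding P_def by blast
    show ?thesis unfolding i D_def c_def case_prod_conv
      using adm i lo \<delta>_pos one_minus_ge[OF i(3,2)] unfolding admissible_def by (intro mult_mono) auto
  qed
  have v_lip: "v i y - v i z \<le> 2 / c * norm (y - z)" if "i \<in> P" for i y z
  proof -
    have n: "norm (fst i) = 1" using that norm_K' unfolding P_def by auto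
    have "norm y - y \<bullet> fst i - (norm z - z \<bullet> fst i) \<le> 2 * norm (y - z)"
      using norm_triangle_ineq2[of y z] norm_cauchy_schwarz[of "z - y" "fst i"] n
      by (simp add: inner_diff_left norm_minus_commute)
    hence "v i y - v i z \<le> 2 * norm (y - z) / D i"
      using D[OF that] c unfolding v_def by (simp add: diff_divide_distrib[symmetric] divide_right_mono)
    also have "\<dots> \<le> 2 * norm (y - z) / c" using D[OF that] c by (intro divide_left_mono) auto
    finally show ?thesis by simp
  qed
  have v0: "v i 0 = 0" for i unfolding v_def by simp
  have bdd: "bdd_above ((\<lambda>i. v i y) ` P)" for y
    using v_lip[of _ y 0] by (intro bdd_aboveI2[where M="2 / c * norm y"]) (simp add: v0)
  have U_ge: "v i y \<le> U y" if "i \<in> P" for i y unfolding U_def by (rule cSUP_upper[OF that bdd])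
  have U_le: "U y \<le> b" if "\<And>i. i \<in> P \<Longrightarrow> v i y \<le> b" for y b unfolding U_def using P_ne that by (rule cSUP_least)
  have U_lip1: "U y - U z \<le> 2 / c * norm (y - z)" for y z
  proof -
    have "U y \<le> U z + 2 / c * norm (y - z)"
    proof (rule U_le)
      fix i assume "i \<in> P"
      thus "v i y \<le> U z + 2 / c * norm (y - z)" using v_lip[of i y z] U_ge[of i z] by linarith
    qed
    thus ?thesis by simp
  qed
  have U_lip: "\<bar>U y - U z\<bar> \<le> 2 / c * norm (y - z)" for y z
    using U_lip1[of y z] U_lip1[of z y] by (simp add: norm_minus_commute abs_le_iff)
  have v_hom: "v i (t *\<^sub>R y) = t * v i y" if "0 < t" for i t y
    using that unfolding v_def by (simp add: right_diff_distrib)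
  have U_hom_le: "U (t *\<^sub>R y) \<le> t * U y" if "0 < t" for t y
    using that by (intro U_le) (simp add: v_hom U_ge)
  have U_hom: "U (t *\<^sub>R y) = t * U y" if "0 < t" for t y
  proof (rule antisym[OF U_hom_le[OF that]])
    have "U y \<le> U (t *\<^sub>R y) / t" using U_hom_le[of "1/t" "t *\<^sub>R y"] that by simp
    thus "t * U y \<le> U (t *\<^sub>R y)" using that by (simp add: pos_le_divide_eq mult.commute)
  qed
  let ?B = "{y. \<exists>p q. p \<noteq> q \<and> subgradient U y p \<and> subgradient U y q}"
  have B: "?B \<in> null_sets lborel" by (rule null_set_multiple_subgradients[OF U_lip])
  \<comment> \<open>Homogeneity of U carries a subgradient at y / |y| to y itself, so the set of
    points with several subgradients contains the open rays through its unit vectors.\<close>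
  have sub_hom: "subgradient U y p" if "y \<noteq> 0" "subgradient U (y /\<^sub>R norm y) p" for y p
    unfolding subgradient_def
  proof
    fix z
    have n: "0 < norm y" using that by simp
    have "U (y /\<^sub>R norm y) + p \<bullet> (z /\<^sub>R norm y - y /\<^sub>R norm y) \<le> U (z /\<^sub>R norm y)"
      using that(2) unfolding subgradient_def by blast
    moreover have "U (w /\<^sub>R norm y) = U w / norm y" for w
      using U_hom[of "inverse (norm y)" w] n by (simp add: divide_inverse mult.commute)
    moreover have "p \<bullet> (z /\<^sub>R norm y - y /\<^sub>R norm y) = (p \<bullet> (z - y)) / norm y"
      by (simp add: scaleR_diff_right[symmetric] divide_inverse mult.commute del: scaleR_diff_right)
    ultimately have "(U y + p \<bullet> (z - y)) / norm y \<le> U z / norm y"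
      by (simp add: add_divide_distrib)
    thus "U y + p \<bullet> (z - y) \<le> U z" using n by (simp add: divide_le_cancel)
  qed
  have "?B \<inter> S2 \<in> null_sets surface_measure"
    by (rule null_sets_surface_measure_cone[OF B]) (use sub_hom in blast)
  moreover have "{x \<in> K. \<not> single_dir \<rho> x} \<subseteq> ?B \<inter> S2"
  proof safe
    fix x assume x: "x \<in> K" "\<not> single_dir \<rho> x"
    show "x \<in> S2" using x K_subset by blast
    then have nx: "norm x = 1" "x \<bullet> x = 1" by (auto simp: dot_square_norm)
    obtain m m' where m: "m \<in> K'" "m' \<in> K'" "touches K \<rho> m x" "touches K \<rho> m' x" "m \<noteq> m'"
      using x unfolding single_dir_def by blast
    \<comment> \<open>(x - m) / D is the gradient at x of the single function
      \<open>v (m, x)\<close>, which lies below U and takes the value 1 / \<rho> x at x.\<close>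
    have sub: "subgradient U x ((x - m) /\<^sub>R D (m, x))" if m: "m \<in> K'" "touches K \<rho> m x" for m
      unfolding subgradient_def
    proof
      fix z
      have i: "(m, x) \<in> P" using m x unfolding P_def by blast
      have Dp: "0 < D (m, x)" using D[OF i] c by simp
      have pos: "0 < 1 - x \<bullet> m" using one_minus_ge[OF x(1) m(1)] \<delta>_pos by simp
      have Ux: "U x \<le> 1 / \<rho> x"
      proof (rule U_le)
        fix i assume i: "i \<in> P"
        then obtain m x0 where i': "i = (m, x0)" "m \<in> K'" "x0 \<in> K" "touches K \<rho> m x0" unfolding P_def by blast
        have "\<rho> x * (1 - x \<bullet> m) \<le> D i" using i' x unfolding touches_def D_def by auto
        moreover have "0 < D i" using D[OF i] c by simp
        ultimately show "v i x \<le> 1 / \<rho> x" using \<rho>[OF x(1)] nx i' unfolding v_def by (simp add: field_simps)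
      qed
      have eq: "1 / \<rho> x = (1 - x \<bullet> m) / D (m, x)" using pos \<rho>[OF x(1)] unfolding D_def by (simp add: field_simps)
      \<comment> \<open>This is the support inequality of the norm at the unit vector x.\<close>
      have "x \<bullet> z \<le> norm z" using norm_cauchy_schwarz[of x z] nx by simp
      hence "(x \<bullet> z - z \<bullet> m) / D (m, x) \<le> v (m, x) z" using Dp unfolding v_def by (intro divide_right_mono) auto
      also have "\<dots> \<le> U z" by (rule U_ge[OF i])
      finally have "(x \<bullet> z - z \<bullet> m) / D (m, x) \<le> U z" .
      moreover have "1 / \<rho> x + ((x - m) /\<^sub>R D (m, x)) \<bullet> (z - x) = (x \<bullet> z - z \<bullet> m) / D (m, x)"
        unfolding eq using nx
        by (simp add: inner_diff_left inner_diff_right inner_commute divide_inverse algebra_simps)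
      ultimately show "U x + ((x - m) /\<^sub>R D (m, x)) \<bullet> (z - x) \<le> U z" using Ux by linarith
    qed
    \<comment> \<open>The squared length of the gradient is 2 / (\<rho>(x)^2 (1 - x \<bullet> m)).
      Equal gradients therefore force equal x \<bullet> m, hence equal D, hence m = m'.\<close>
    have "(x - m) /\<^sub>R D (m, x) \<noteq> (x - m') /\<^sub>R D (m', x)"
    proof
      assume eq: "(x - m) /\<^sub>R D (m, x) = (x - m') /\<^sub>R D (m', x)"
      have sq: "((x - m) /\<^sub>R D (m, x)) \<bullet> ((x - m) /\<^sub>R D (m, x)) = 2 / (\<rho> x ^ 2 * (1 - x \<bullet> m))" if m: "m \<in> K'" for m
      proof -
        have nm: "m \<bullet> m = 1" using norm_K'[OF m] by (simp add: dot_square_norm)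
        have pos: "0 < 1 - x \<bullet> m" using one_minus_ge[OF x(1) m(1)] \<delta>_pos by simp
        have "(x - m) \<bullet> (x - m) = 2 * (1 - x \<bullet> m)" using nx nm by (simp add: inner_diff_left inner_diff_right inner_commute)
        moreover have "((x - m) /\<^sub>R D (m, x)) \<bullet> ((x - m) /\<^sub>R D (m, x)) = ((x - m) \<bullet> (x - m)) / (D (m, x))\<^sup>2"
          by (simp only: inner_scaleR_left inner_scaleR_right divide_inverse power2_eq_square inverse_mult_distrib mult_ac)
        ultimately have *: "((x - m) /\<^sub>R D (m, x)) \<bullet> ((x - m) /\<^sub>R D (m, x)) = 2 * (1 - x \<bullet> m) / (D (m, x))\<^sup>2"
          by metis
        have "2 * t / (r * t)\<^sup>2 = 2 / (r\<^sup>2 * t)" if "0 < t" for r t :: real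
          using that by (simp add: power_mult_distrib power2_eq_square)
        from this[OF pos] have "2 * (1 - x \<bullet> m) / (D (m, x))\<^sup>2 = 2 / ((\<rho> x)\<^sup>2 * (1 - x \<bullet> m))"
          unfolding D_def by (simp only: case_prod_conv)
        with * show ?thesis by (rule trans)
      qed
      have "2 / (\<rho> x ^ 2 * (1 - x \<bullet> m)) = 2 / (\<rho> x ^ 2 * (1 - x \<bullet> m'))"
        using sq[OF m(1)] sq[OF m(2)] eq by metis
      hence "x \<bullet> m = x \<bullet> m'"
        using \<rho>[OF x(1)] one_minus_ge[OF x(1) m(1)] one_minus_ge[OF x(1) m(2)] \<delta>_pos
        by (simp add: field_simps)
      hence "D (m, x) = D (m', x)" unfolding D_def by simp
      moreover have "D (m, x) > 0" using D[of "(m, x)"] c m x unfolding P_def by auto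
      ultimately show False using eq m(5) by simp
    qed
    thus "\<exists>p q. p \<noteq> q \<and> subgradient U x p \<and> subgradient U x q" using sub m by blast
  qed
  ultimately show ?thesis
    using complete_measure.complete2[OF complete_surface_measure] by blast
qed auto

text \<open>The base points may move with n. Pointwise convergence of the radial functions does not
  control \<open>\<rho>s n (x n)\<close>, so the limit of that sequence is a separate
  hypothesis.\<close>

lemma touches_limit:
  assumes "\<And>y. y \<in> K \<Longrightarrow> (\<lambda>n. \<rho>s n y) \<longlonglongrightarrow> \<rho> y" "(\<lambda>n. \<rho>s n (x n)) \<longlonglongrightarrow> \<rho> l" "x \<longlonglongrightarrow> l" "m \<longlonglongrightarrow> m'"
    and "\<And>n. touches K (\<rho>s n) (m n) (x n)"
  shows "touches K \<rho> m' l"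
  unfolding touches_def
proof
  fix y assume y: "y \<in> K"
  have "(\<lambda>n. \<rho>s n y * (1 - y \<bullet> m n)) \<longlonglongrightarrow> \<rho> y * (1 - y \<bullet> m')"
    by (intro tendsto_intros assms y)
  moreover have "(\<lambda>n. \<rho>s n (x n) * (1 - x n \<bullet> m n)) \<longlonglongrightarrow> \<rho> l * (1 - l \<bullet> m')"
    by (intro tendsto_intros assms)
  ultimately show "\<rho> y * (1 - y \<bullet> m') \<le> \<rho> l * (1 - l \<bullet> m')"
    by (rule LIMSEQ_le) (use assms(5) y in \<open>auto simp: touches_def\<close>)
qed

text \<open>If the directions stayed away from m' along a subsequence, compactness of K' would yield
  another limit, which also touches at l, against uniqueness there. Uniqueness is asked at the limit
  only, so the statement covers both moving points under a fixed \<rho> and moving radial functions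
  at a fixed point.\<close>

lemma directions_converge:
  assumes \<rho>s: "\<And>y. y \<in> K \<Longrightarrow> (\<lambda>n. \<rho>s n y) \<longlonglongrightarrow> \<rho> y" and \<rho>x: "(\<lambda>n. \<rho>s n (x n)) \<longlonglongrightarrow> \<rho> l" and x: "x \<longlonglongrightarrow> l"
    and m: "\<And>n. m n \<in> K'" "\<And>n. touches K (\<rho>s n) (m n) (x n)"
    and m': "m' \<in> K'" "touches K \<rho> m' l" and l: "single_dir \<rho> l"
  shows "m \<longlonglongrightarrow> m'"
proof (rule ccontr)
  assume "\<not> m \<longlonglongrightarrow> m'"
  then obtain e where e: "0 < e" "\<not> (\<forall>\<^sub>F n in sequentially. dist (m n) m' < e)"
    unfolding tendsto_iff by blast
  hence "\<exists>\<^sub>F n in sequentially. \<not> dist (m n) m' < e" by (simp add: frequently_def)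
  then obtain r where r: "strict_mono (r :: nat \<Rightarrow> nat)" "\<And>n. \<not> dist (m (r n)) m' < e"
    using infinite_enumerate[of "{n. \<not> dist (m n) m' < e}"]
    by (auto simp: frequently_cofinite[symmetric] cofinite_eq_sequentially)
  obtain l' s where s: "l' \<in> K'" "strict_mono (s :: nat \<Rightarrow> nat)" "((m \<circ> r) \<circ> s) \<longlonglongrightarrow> l'"
    using compact_K' m(1) unfolding compact_def by (metis comp_apply)
  have rs: "strict_mono (r \<circ> s)" using r s by (simp add: strict_mono_o)
  note sub = LIMSEQ_subseq_LIMSEQ[OF _ rs, unfolded o_def]
  have "touches K \<rho> l' l"
    by (rule touches_limit[where \<rho>s="\<lambda>n. \<rho>s (r (s n))" and x="\<lambda>n. x (r (s n))" and m="\<lambda>n. m (r (s n))"])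
      (use sub[OF \<rho>s] sub[OF \<rho>x] sub[OF x] s m in \<open>auto simp: o_def\<close>)
  hence "l' = m'" using l m' s unfolding single_dir_def by blast
  hence "\<forall>\<^sub>F n in sequentially. dist (m (r (s n))) m' < e" 
    using s(3) e(1) unfolding tendsto_iff o_def by blast
  thus False using r(2) by (auto simp: eventually_sequentially)
qed

lemma continuous_on_dir:
  assumes adm: "admissible lo hi \<rho>" and lo: "0 < lo"
  shows "continuous_on {x \<in> K. single_dir \<rho> x} (dir \<rho>)"
  unfolding continuous_on_sequentially
proof (intro allI ballI impI, elim conjE)
  fix x l assume x: "\<forall>n. x n \<in> {x \<in> K. single_dir \<rho> x}" and l: "l \<in> {x \<in> K. single_dir \<rho> x}" and lim: "x \<longlonglongrightarrow> l"
  have "(\<lambda>n. \<rho> (x n)) \<longlonglongrightarrow> \<rho> l"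
    using admissible_continuous[OF adm lo] x l lim unfolding continuous_on_sequentially o_def by auto
  thus "(dir \<rho> \<circ> x) \<longlonglongrightarrow> dir \<rho> l"
    by (rule directions_converge[where x=x and l=l and \<rho>="\<rho>" and \<rho>s="\<lambda>_. \<rho>", rotated])
      (use x l lim dir_props[OF adm] in \<open>auto simp: o_def\<close>)
qed

end

section \<open>The transported measure\<close>

locale flux_setup = separated_directions +
  fixes f :: "real^3 \<Rightarrow> real"
  assumes f_integrable: "set_integrable surface_measure K f"
    and f_nonneg: "AE x in surface_measure. x \<in> K \<longrightarrow> 0 \<le> f x"
begin

text \<open>For unit vectors x and m, x \<bullet> (x - m) = 1 - x \<bullet> m and |x - m| = sqrt (2
  (1 - x \<bullet> m)). The square root is thus the cosine between x and the normal (x - m) / |x -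
  m|.\<close>

definition weight :: "(real^3 \<Rightarrow> real) \<Rightarrow> real^3 \<Rightarrow> real" where
  "weight \<rho> x = sqrt ((1 - x \<bullet> dir \<rho> x) / 2) / (\<rho> x)\<^sup>2"

text \<open>Integral of \<phi> against the transported measure, the image under \<open>dir\<close>
  of f times the weight. With test functions, weak convergence of transported measures becomes
  convergence of numbers.\<close>

definition flux :: "(real^3 \<Rightarrow> real) \<Rightarrow> (real^3 \<Rightarrow> real) \<Rightarrow> real" where
  "flux \<rho> \<phi> = (LINT x:K|surface_measure. f x * (weight \<rho> x * \<phi> (dir \<rho> x)))"

lemma K_sets: "K \<in> sets surface_measure"
  using sets_surface_measureI[OF borel_compact[OF compact_K]] K_subset by (simp add: Int_absorb2)

lemma AE_single_dir:
  assumes "admissible lo hi \<rho>" "0 < lo"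
  shows "AE x in surface_measure. x \<in> K \<longrightarrow> single_dir \<rho> x"
  using AE_not_in[OF null_set_not_single_dir[OF assms]] by eventually_elim auto

text \<open>All bounds come from \<delta> \<le> 1 - x \<bullet> m \<le> 2. The last one replaces
  sqrt (\<delta>/2) by the smaller \<delta>/2; with hi = a'/\<delta> it becomes the constant C(a',
  \<delta>).\<close>

lemma weight_bounds:
  assumes adm: "admissible lo hi \<rho>" and lo: "0 < lo" and x: "x \<in> K"
  shows "0 \<le> weight \<rho> x" "weight \<rho> x \<le> 1 / lo\<^sup>2" "\<delta> \<le> 1 \<Longrightarrow> \<delta> / (2 * hi\<^sup>2) \<le> weight \<rho> x"
proof -
  have m: "dir \<rho> x \<in> K'" by (rule dir_props[OF adm x])
  have \<rho>: "lo \<le> \<rho> x" "\<rho> x \<le> hi" using adm x unfolding admissible_def by auto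
  let ?t = "(1 - x \<bullet> dir \<rho> x) / 2"
  have t: "\<delta> / 2 \<le> ?t" "?t \<le> 1" "0 \<le> ?t"
    using one_minus_ge[OF x m] one_minus_le[OF x m] \<delta>_pos by auto
  show "0 \<le> weight \<rho> x" unfolding weight_def using t by simp
  have "sqrt ?t \<le> 1" using t by (simp only: real_sqrt_le_1_iff)
  moreover have "lo\<^sup>2 \<le> (\<rho> x)\<^sup>2" using \<rho> lo by (intro power_mono) auto
  ultimately show "weight \<rho> x \<le> 1 / lo\<^sup>2" unfolding weight_def using lo by (intro frac_le) auto
  assume "\<delta> \<le> 1"
  have "\<delta> / 2 \<le> sqrt (\<delta> / 2)" using \<delta>_pos \<open>\<delta> \<le> 1\<close>
    by (intro real_le_rsqrt) (simp add: power2_eq_square)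
  also have "\<dots> \<le> sqrt ?t" using t by (intro real_sqrt_le_mono)
  finally have "\<delta> / 2 \<le> sqrt ?t" .
  moreover have "(\<rho> x)\<^sup>2 \<le> hi\<^sup>2" using \<rho> lo by (intro power_mono) auto
  ultimately have "(\<delta> / 2) / hi\<^sup>2 \<le> weight \<rho> x" unfolding weight_def using \<rho> lo t by (intro frac_le) auto
  thus "\<delta> / (2 * hi\<^sup>2) \<le> weight \<rho> x" by simp
qed

lemma weight_integrand_measurable:
  assumes adm: "admissible lo hi \<rho>" and lo: "0 < lo" and \<phi>: "continuous_on K' \<phi>"
  shows "(\<lambda>x. indicator K x *\<^sub>R (weight \<rho> x * \<phi> (dir \<rho> x))) \<in> borel_measurable surface_measure"
proof (rule surface_measurable_if_continuous_on[where R="{x \<in> K. single_dir \<rho> x}"])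
  have "K - {x \<in> K. single_dir \<rho> x} = {x \<in> K. \<not> single_dir \<rho> x}" by auto
  thus "K - {x \<in> K. single_dir \<rho> x} \<in> null_sets surface_measure"
    using null_set_not_single_dir[OF adm lo] by simp
  note c = continuous_on_dir[OF adm lo]
  have "continuous_on {x \<in> K. single_dir \<rho> x} \<rho>"
    by (rule continuous_on_subset[OF admissible_continuous[OF adm lo]]) auto
  moreover have "continuous_on {x \<in> K. single_dir \<rho> x} (\<lambda>x. \<phi> (dir \<rho> x))"
    by (rule continuous_on_compose2[OF \<phi> c]) (use dir_props[OF adm] in auto)
  ultimately show "continuous_on {x \<in> K. single_dir \<rho> x} (\<lambda>x. weight \<rho> x * \<phi> (dir \<rho> x))"
    unfolding weight_def using adm lo
    by (intro continuous_intros c) (auto simp: admissible_def dest!: bspec)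
qed (auto simp: K_sets)

lemma flux_integrand_bound:
  assumes adm: "admissible lo hi \<rho>" and lo: "0 < lo" and B: "\<And>m. m \<in> K' \<Longrightarrow> \<bar>\<phi> m\<bar> \<le> B"
  shows "norm (indicator K x *\<^sub>R (f x * (weight \<rho> x * \<phi> (dir \<rho> x)))) \<le> norm ((1 / lo\<^sup>2 * B) * (indicator K x *\<^sub>R f x))"
proof (cases "x \<in> K")
  case True
  have "\<bar>weight \<rho> x * \<phi> (dir \<rho> x)\<bar> \<le> 1 / lo\<^sup>2 * B"
    unfolding abs_mult
    using weight_bounds[OF adm lo True] B[OF dir_props(1)[OF adm True]] by (intro mult_mono) auto
  hence "\<bar>weight \<rho> x * \<phi> (dir \<rho> x)\<bar> \<le> \<bar>1 / lo\<^sup>2 * B\<bar>" by linarith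
  hence "\<bar>f x\<bar> * \<bar>weight \<rho> x * \<phi> (dir \<rho> x)\<bar> \<le> \<bar>f x\<bar> * \<bar>1 / lo\<^sup>2 * B\<bar>"
    by (intro mult_left_mono) auto
  thus ?thesis using True by (simp add: abs_mult mult_ac)
qed simp

lemma flux_integrable:
  assumes adm: "admissible lo hi \<rho>" and lo: "0 < lo" and \<phi>: "continuous_on K' \<phi>"
  shows "set_integrable surface_measure K (\<lambda>x. f x * (weight \<rho> x * \<phi> (dir \<rho> x)))"
proof -
  obtain B where B: "\<And>m. m \<in> K' \<Longrightarrow> \<bar>\<phi> m\<bar> \<le> B"
    using compact_imp_bounded[OF compact_continuous_image[OF \<phi> compact_K']] unfolding bounded_iff by auto
  have m: "(\<lambda>x. indicator K x *\<^sub>R (f x * (weight \<rho> x * \<phi> (dir \<rho> x)))) \<in> borel_measurable surface_measure"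
  proof -
    \<comment> \<open>Measurability of f is known only after cutting off to K, so each factor
      carries its own indicator.\<close>
    have "(\<lambda>x. (indicator K x *\<^sub>R f x) * (indicator K x *\<^sub>R (weight \<rho> x * \<phi> (dir \<rho> x)))) \<in> borel_measurable surface_measure"
      using f_integrable unfolding set_integrable_def
      by (intro borel_measurable_times weight_integrand_measurable[OF adm lo \<phi>]) auto
    moreover have "(indicator K x *\<^sub>R f x) * (indicator K x *\<^sub>R (weight \<rho> x * \<phi> (dir \<rho> x)))
      = indicator K x *\<^sub>R (f x * (weight \<rho> x * \<phi> (dir \<rho> x)))" for x by (simp add: indicator_def)
    ultimately show ?thesis by (simp only:)
  qed
  show ?thesis
    unfolding set_integrable_def
  proof (rule Bochner_Integration.integrable_bound[OF _ m])
    show "integrable surface_measure (\<lambda>x. (1 / lo\<^sup>2 * B) * (indicator K x *\<^sub>R f x))"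
      using f_integrable unfolding set_integrable_def by (intro integrable_mult_right)
    show "AE x in surface_measure. norm (indicator K x *\<^sub>R (f x * (weight \<rho> x * \<phi> (dir \<rho> x))))
      \<le> norm ((1 / lo\<^sup>2 * B) * (indicator K x *\<^sub>R f x))"
      by (intro always_eventually allI flux_integrand_bound[where \<phi>=\<phi>, OF adm lo B])
  qed
qed

text \<open>The two sides may belong to different surfaces; since f is nonnegative almost everywhere
  on K, a pointwise comparison of weighted test values suffices.\<close>

lemma flux_mono_AE:
  assumes "admissible lo hi \<rho>" "admissible lo' hi' \<rho>'" "0 < lo" "0 < lo'"
    and "continuous_on K' \<phi>" "continuous_on K' \<psi>"
    and "AE x in surface_measure. x \<in> K \<longrightarrow> weight \<rho> x * \<phi> (dir \<rho> x) \<le> weight \<rho>' x * \<psi> (dir \<rho>' x)"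
  shows "flux \<rho> \<phi> \<le> flux \<rho>' \<psi>"
  unfolding flux_def set_lebesgue_integral_def
proof (rule integral_mono_AE)
  show "AE x in surface_measure. indicator K x *\<^sub>R (f x * (weight \<rho> x * \<phi> (dir \<rho> x)))
      \<le> indicator K x *\<^sub>R (f x * (weight \<rho>' x * \<psi> (dir \<rho>' x)))"
    using assms(7) f_nonneg by eventually_elim (auto simp: indicator_def intro: mult_left_mono)
qed (use flux_integrable assms in \<open>auto simp: set_integrable_def\<close>)

lemma flux_cong_AE:
  assumes "admissible lo hi \<rho>" "0 < lo" "continuous_on K' \<phi>" "continuous_on K' \<psi>"
    and "AE x in surface_measure. x \<in> K \<longrightarrow> \<phi> (dir \<rho> x) = \<psi> (dir \<rho> x)"
  shows "flux \<rho> \<phi> = flux \<rho> \<psi>"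
proof (rule antisym)
  show "flux \<rho> \<phi> \<le> flux \<rho> \<psi>" "flux \<rho> \<psi> \<le> flux \<rho> \<phi>"
    by (rule flux_mono_AE[OF assms(1,1,2,2)]; use assms(3-) in auto)+
qed

lemma flux_0: "flux \<rho> (\<lambda>_. 0) = 0"
  unfolding flux_def set_lebesgue_integral_def by simp

lemma flux_add:
  assumes "admissible lo hi \<rho>" "0 < lo" "continuous_on K' \<phi>" "continuous_on K' \<psi>"
  shows "flux \<rho> (\<lambda>m. \<phi> m + \<psi> m) = flux \<rho> \<phi> + flux \<rho> \<psi>"
  unfolding flux_def
  by (subst set_integral_add(2)[symmetric])
    (use flux_integrable assms in \<open>auto simp: algebra_simps\<close>)

lemma flux_cmult: "flux \<rho> (\<lambda>m. c * \<phi> m) = c * flux \<rho> \<phi>"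
  unfolding flux_def by (subst set_integral_mult_right[symmetric]) (simp add: mult_ac)

lemma flux_sum:
  assumes "admissible lo hi \<rho>" "0 < lo" "finite M" "\<And>j. j \<in> M \<Longrightarrow> continuous_on K' (\<phi> j)"
  shows "flux \<rho> (\<lambda>m. \<Sum>j\<in>M. \<phi> j m) = (\<Sum>j\<in>M. flux \<rho> (\<phi> j))"
  using assms(3,4)
proof (induction M rule: finite_induct)
  case (insert j M)
  have "flux \<rho> (\<lambda>m. \<phi> j m + (\<Sum>j\<in>M. \<phi> j m)) = flux \<rho> (\<phi> j) + flux \<rho> (\<lambda>m. \<Sum>j\<in>M. \<phi> j m)"
    by (rule flux_add[OF assms(1,2)]) (use insert in \<open>auto intro!: continuous_on_sum\<close>)
  thus ?case using insert by simp
qed (simp add: flux_0)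

lemma flux_total_ge:
  assumes adm: "admissible lo hi \<rho>" and lo: "0 < lo" and \<delta>: "\<delta> \<le> 1"
  shows "\<delta> / (2 * hi\<^sup>2) * (LINT x:K|surface_measure. f x) \<le> flux \<rho> (\<lambda>_. 1)"
proof -
  have "\<delta> / (2 * hi\<^sup>2) * (LINT x:K|surface_measure. f x) = (LINT x:K|surface_measure. f x * (\<delta> / (2 * hi\<^sup>2)))"
    by (subst set_integral_mult_left) simp
  also have "\<dots> \<le> flux \<rho> (\<lambda>_. 1)"
    unfolding flux_def set_lebesgue_integral_def
  proof (rule integral_mono_AE)
    show "AE x in surface_measure. indicator K x *\<^sub>R (f x * (\<delta> / (2 * hi\<^sup>2)))
        \<le> indicator K x *\<^sub>R (f x * (weight \<rho> x * 1))"
      using f_nonneg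
    proof eventually_elim
      case (elim x)
      have "f x * (\<delta> / (2 * hi\<^sup>2)) \<le> f x * weight \<rho> x" if "x \<in> K"
        using elim weight_bounds(3)[OF adm lo that \<delta>] that by (intro mult_left_mono) auto
      thus ?case by (cases "x \<in> K") auto
    qed
    show "integrable surface_measure (\<lambda>x. indicator K x *\<^sub>R (f x * (weight \<rho> x * 1)))"
      using flux_integrable[OF adm lo, of "\<lambda>_. 1"] unfolding set_integrable_def by simp
    show "integrable surface_measure (\<lambda>x. indicator K x *\<^sub>R (f x * (\<delta> / (2 * hi\<^sup>2))))"
      using integrable_mult_left[of "\<delta> / (2 * hi\<^sup>2)" surface_measure "\<lambda>x. indicator K x *\<^sub>R f x"] f_integrable
      unfolding set_integrable_def by (simp add: mult_ac)
  qed
  finally show ?thesis .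
qed

text \<open>The weights are bounded by 1 / lo^2 uniformly in n, so a multiple of |f| on K dominates.
  The pointwise limit is taken off the null set where the limit surface has several
  directions.\<close>

lemma flux_tendsto:
  assumes adms: "\<And>n. admissible lo hi (\<rho>s n)" and adm: "admissible lo hi \<rho>" and lo: "0 < lo"
    and \<phi>: "continuous_on K' \<phi>" and lim: "\<And>x. x \<in> K \<Longrightarrow> (\<lambda>n. \<rho>s n x) \<longlonglongrightarrow> \<rho> x"
  shows "(\<lambda>n. flux (\<rho>s n) \<phi>) \<longlonglongrightarrow> flux \<rho> \<phi>"
proof -
  obtain B where B: "\<And>m. m \<in> K' \<Longrightarrow> \<bar>\<phi> m\<bar> \<le> B"
    using compact_imp_bounded[OF compact_continuous_image[OF \<phi> compact_K']] unfolding bounded_iff by auto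
  show ?thesis
    unfolding flux_def set_lebesgue_integral_def
  proof (rule integral_dominated_convergence[where w="\<lambda>x. norm ((1 / lo\<^sup>2 * B) * (indicator K x *\<^sub>R f x))"])
    show "integrable surface_measure (\<lambda>x. norm ((1 / lo\<^sup>2 * B) * (indicator K x *\<^sub>R f x)))"
      using f_integrable unfolding set_integrable_def by (intro integrable_norm integrable_mult_right)
    show "(\<lambda>x. indicator K x *\<^sub>R (f x * (weight \<rho> x * \<phi> (dir \<rho> x)))) \<in> borel_measurable surface_measure"
      using flux_integrable[OF adm lo \<phi>] unfolding set_integrable_def by auto
    show "(\<lambda>x. indicator K x *\<^sub>R (f x * (weight (\<rho>s n) x * \<phi> (dir (\<rho>s n) x)))) \<in> borel_measurable surface_measure" for n
      using flux_integrable[OF adms[of n] lo \<phi>] unfolding set_integrable_def by auto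
    show "AE x in surface_measure. norm (indicator K x *\<^sub>R (f x * (weight (\<rho>s n) x * \<phi> (dir (\<rho>s n) x))))
      \<le> norm ((1 / lo\<^sup>2 * B) * (indicator K x *\<^sub>R f x))" for n
      by (intro always_eventually allI flux_integrand_bound[where \<phi>=\<phi>, OF adms lo B])
    show "AE x in surface_measure. (\<lambda>n. indicator K x *\<^sub>R (f x * (weight (\<rho>s n) x * \<phi> (dir (\<rho>s n) x))))
        \<longlonglongrightarrow> indicator K x *\<^sub>R (f x * (weight \<rho> x * \<phi> (dir \<rho> x)))"
      using AE_single_dir[OF adm lo]
    proof eventually_elim
      case (elim x)
      show ?case
      proof (cases "x \<in> K")
        case True
        have d: "(\<lambda>n. dir (\<rho>s n) x) \<longlonglongrightarrow> dir \<rho> x"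
          by (rule directions_converge[where \<rho>s=\<rho>s and x="\<lambda>_. x" and l=x and \<rho>=\<rho>])
            (use elim True lim dir_props[OF adms True] dir_props[OF adm True] in auto)
        have "(\<lambda>n. \<phi> (dir (\<rho>s n) x)) \<longlonglongrightarrow> \<phi> (dir \<rho> x)"
          by (rule continuous_on_tendsto_compose[OF \<phi> d])
            (use dir_props[OF adms True] dir_props[OF adm True] in auto)
        moreover have "(\<rho> x)\<^sup>2 \<noteq> 0" using adm lo True unfolding admissible_def by fastforce
        ultimately show ?thesis unfolding weight_def
          by (intro tendsto_intros d lim True) auto
      qed simp
    qed
  qed
qed

end

section \<open>Finitely many directions\<close>

lemma tendsto_Min_image:
  fixes g :: "nat \<Rightarrow> 'a \<Rightarrow> real"
  assumes "finite M" "M \<noteq> {}" "\<And>m. m \<in> M \<Longrightarrow> (\<lambda>n. g n m) \<longlonglongrightarrow> l m"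
  shows "(\<lambda>n. Min (g n ` M)) \<longlonglongrightarrow> Min (l ` M)"
  using assms
proof (induction M rule: finite_ne_induct)
  case (insert m M)
  thus ?case by (simp add: tendsto_min)
qed simp

text \<open>Compactness of a box, by extraction one coordinate at a time, for functions that are
  controlled only on the finite set M.\<close>

lemma finite_bounded_convergent_subsequence:
  fixes d :: "nat \<Rightarrow> 'a \<Rightarrow> real"
  assumes "finite M" "\<And>n m. m \<in> M \<Longrightarrow> \<bar>d n m\<bar> \<le> B"
  shows "\<exists>r l. strict_mono (r :: nat \<Rightarrow> nat) \<and> (\<forall>m\<in>M. (\<lambda>n. d (r n) m) \<longlonglongrightarrow> l m)"
  using assms
proof (induction M rule: finite_induct)
  case empty
  show ?case by (intro exI[of _ id]) (simp add: strict_mono_def)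
next
  case (insert m M)
  obtain r l where r: "strict_mono (r :: nat \<Rightarrow> nat)" "\<forall>m\<in>M. (\<lambda>n. d (r n) m) \<longlonglongrightarrow> l m"
    using insert by auto
  have "bounded (range (\<lambda>n. d (r n) m))" using insert by (auto simp: bounded_iff)
  from bounded_imp_convergent_subsequence[OF this] obtain l' s
    where s: "strict_mono (s :: nat \<Rightarrow> nat)" "(\<lambda>n. d (r (s n)) m) \<longlonglongrightarrow> l'" by (auto simp: o_def)
  have "(\<lambda>n. d (r (s n)) k) \<longlonglongrightarrow> (l(m := l')) k" if "k \<in> insert m M" for k
    using that s(2) LIMSEQ_subseq_LIMSEQ[OF _ s(1), of "\<lambda>n. d (r n) k"] r(2) insert(2) by (auto simp: o_def)
  thus ?case using strict_mono_o[OF r(1) s(1)]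
    by (intro exI[of _ "r \<circ> s"] exI[of _ "l(m := l')"]) (auto simp: o_def)
qed

text \<open>A continuous stand-in for the indicator of j on M, so that the mass received by one of
  finitely many directions can be read off with a continuous test function.\<close>

lemma isolating_bump:
  fixes j :: "'a::metric_space"
  assumes "finite M"
  shows "\<exists>\<beta>::'a \<Rightarrow> real. continuous_on UNIV \<beta> \<and> (\<forall>m. 0 \<le> \<beta> m) \<and> \<beta> j = 1 \<and> (\<forall>m\<in>M. m \<noteq> j \<longrightarrow> \<beta> m = 0)"
proof -
  obtain r where r: "0 < r" "\<forall>m\<in>M. m \<noteq> j \<longrightarrow> r \<le> dist j m"
    using finite_set_avoid[OF assms, of j] by blast
  show ?thesis
    using r by (intro exI[of _ "\<lambda>m. max 0 (1 - dist j m / r)"]) (intro conjI continuous_intros; auto)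
qed

section \<open>Envelopes of finitely many paraboloids\<close>

context separated_directions
begin

text \<open>The boundary, seen from the common focus, of the intersection of the regions enclosed by
  the paraboloids with axes m in M and parameters d m.\<close>

definition envelope :: "(real^3) set \<Rightarrow> (real^3 \<Rightarrow> real) \<Rightarrow> real^3 \<Rightarrow> real" where
  "envelope M d x = Min ((\<lambda>m. d m / (1 - x \<bullet> m)) ` M)"

context
  fixes M :: "(real^3) set"
  assumes fin: "finite M" and ne: "M \<noteq> {}" and MK: "M \<subseteq> K'"
begin

lemma envelope_le: "m \<in> M \<Longrightarrow> envelope M d x \<le> d m / (1 - x \<bullet> m)"
  unfolding envelope_def using fin by (intro Min_le) auto

lemma envelope_attained: "\<exists>m\<in>M. envelope M d x = d m / (1 - x \<bullet> m)"
  using Min_in[of "(\<lambda>m. d m / (1 - x \<bullet> m)) ` M"] fin ne unfolding envelope_def by (auto simp del: Min_in)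

lemma envelope_touches:
  assumes "m \<in> M" "x \<in> K" "envelope M d x = d m / (1 - x \<bullet> m)"
  shows "touches K (envelope M d) m x"
  unfolding touches_def
proof
  fix y assume y: "y \<in> K"
  have p: "0 < 1 - y \<bullet> m" "0 < 1 - x \<bullet> m"
    using one_minus_ge[OF y, of m] one_minus_ge[of x m] assms MK \<delta>_pos by auto
  show "envelope M d y * (1 - y \<bullet> m) \<le> envelope M d x * (1 - x \<bullet> m)"
    using envelope_le[OF assms(1), of d y] p unfolding assms(3) by (simp add: pos_le_divide_eq)
qed

text \<open>The lower bound uses 1 - x \<bullet> m \<le> 2, whence the factor in 2 * lo. The upper
  bound comes from the paraboloid of \<open>m0\<close> alone, so it stays the same when the other
  parameters vary.\<close>

lemma envelope_admissible:
  assumes d: "\<And>m. m \<in> M \<Longrightarrow> 2 * lo \<le> d m" and m0: "m0 \<in> M" and lo: "0 \<le> lo"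
  shows "admissible lo (d m0 / \<delta>) (envelope M d)"
  unfolding admissible_def
proof (intro conjI ballI)
  fix x assume x: "x \<in> K"
  obtain m where m: "m \<in> M" "envelope M d x = d m / (1 - x \<bullet> m)" using envelope_attained by blast
  have p: "\<delta> \<le> 1 - x \<bullet> m" "1 - x \<bullet> m \<le> 2" using one_minus_ge one_minus_le x m MK by auto
  have "2 * lo / 2 \<le> d m / (1 - x \<bullet> m)" using p d[OF m(1)] lo \<delta>_pos by (intro frac_le) auto
  thus "lo \<le> envelope M d x" using m by simp
  have "envelope M d x \<le> d m0 / (1 - x \<bullet> m0)" by (rule envelope_le[OF m0])
  also have "\<dots> \<le> d m0 / \<delta>" using one_minus_ge[OF x, of m0] m0 MK \<delta>_pos d[OF m0] lo by (intro frac_le) auto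
  finally show "envelope M d x \<le> d m0 / \<delta>" .
  show "\<exists>m\<in>K'. touches K (envelope M d) m x" using envelope_touches[OF m(1) x m(2)] m MK by blast
qed

text \<open>A direction attaining the minimum touches, so where the touching direction is unique it
  is that one. In particular it lies in the finite set M and not merely in K'.\<close>

lemma envelope_dir:
  assumes adm: "admissible lo hi (envelope M d)" and x: "x \<in> K" "single_dir (envelope M d) x"
  shows "dir (envelope M d) x \<in> M"
    "envelope M d x = d (dir (envelope M d) x) / (1 - x \<bullet> dir (envelope M d) x)"
proof -
  obtain m where m: "m \<in> M" "envelope M d x = d m / (1 - x \<bullet> m)" using envelope_attained by blast
  have "dir (envelope M d) x = m"
    using dir_eqI[OF adm x] envelope_touches[OF m(1) x(1) m(2)] m MK by blast
  thus "dir (envelope M d) x \<in> M"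
    "envelope M d x = d (dir (envelope M d) x) / (1 - x \<bullet> dir (envelope M d) x)" using m by auto
qed

lemma envelope_tendsto:
  assumes "\<And>m. m \<in> M \<Longrightarrow> (\<lambda>n. d n m) \<longlonglongrightarrow> l m" and "x \<in> K"
  shows "(\<lambda>n. envelope M (d n) x) \<longlonglongrightarrow> envelope M l x"
  unfolding envelope_def
proof (rule tendsto_Min_image[OF fin ne])
  fix m assume m: "m \<in> M"
  hence "1 - x \<bullet> m \<noteq> 0" using one_minus_ge[OF assms(2), of m] MK \<delta>_pos by auto
  thus "(\<lambda>n. d n m / (1 - x \<bullet> m)) \<longlonglongrightarrow> l m / (1 - x \<bullet> m)"
    by (intro tendsto_intros assms(1) m)
qed

lemma envelope_mono:
  assumes "\<And>m. m \<in> M \<Longrightarrow> d m \<le> d' m" and "x \<in> K"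
  shows "envelope M d x \<le> envelope M d' x"
proof -
  obtain m where m: "m \<in> M" "envelope M d' x = d' m / (1 - x \<bullet> m)" using envelope_attained by blast
  have "0 < 1 - x \<bullet> m" using one_minus_ge[OF assms(2), of m] m MK \<delta>_pos by auto
  hence "d m / (1 - x \<bullet> m) \<le> d' m / (1 - x \<bullet> m)" using assms(1)[OF m(1)] by (intro divide_right_mono) auto
  thus ?thesis using envelope_le[OF m(1), of d x] m(2) by linarith
qed

end

end

section \<open>Minimisation over finitely many polar parameters\<close>

context flux_setup
begin

text \<open>The lower bound on \<rho> x * (1 - x \<bullet> m) controls the parameter of a touching
  paraboloid in a form that passes to limits of surfaces. The number c is the surplus arriving at
  \<open>m0\<close>.\<close>

lemma discrete_reflector_exists:
  assumes fin: "finite M" and MK: "M \<subseteq> K'" and m0: "m0 \<in> M"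
    and b: "\<And>m. m \<in> M \<Longrightarrow> 0 \<le> b m" "0 < b m0"
    and \<delta>1: "\<delta> \<le> 1" and a': "0 < a'"
    and total: "sum b M \<le> \<delta>^3 / (2 * a'\<^sup>2) * (LINT x:K|surface_measure. f x)"
  shows "\<exists>\<rho> c. admissible (\<delta> * a' / 4) (a' / \<delta>) \<rho> \<and> 0 \<le> c
    \<and> (\<forall>x\<in>K. \<exists>m\<in>K'. touches K \<rho> m x \<and> \<delta> * a' / 2 \<le> \<rho> x * (1 - x \<bullet> m))
    \<and> (\<forall>\<phi>. continuous_on K' \<phi> \<longrightarrow> flux \<rho> \<phi> = (\<Sum>m\<in>M. b m * \<phi> m) + c * \<phi> m0)"
proof -
  have ne: "M \<noteq> {}" using m0 by auto
  \<comment> \<open>Half the lower bound of the conclusion. The constraint 2 * lo \<le> d m holds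
    with room to spare at feasible points, where \<open>far\<close> gives 4 * lo, so a parameter can
    be decreased without leaving the box.\<close>
  define lo where "lo = \<delta> * a' / 8"
  have lo: "0 < lo" unfolding lo_def using \<delta>_pos a' by simp
  have "\<forall>j. \<exists>\<beta>::real^3 \<Rightarrow> real. continuous_on UNIV \<beta> \<and> (\<forall>m. 0 \<le> \<beta> m) \<and> \<beta> j = 1 \<and> (\<forall>m\<in>M. m \<noteq> j \<longrightarrow> \<beta> m = 0)"
    using isolating_bump[OF fin] by blast
  from choice[OF this] obtain \<beta> :: "real^3 \<Rightarrow> real^3 \<Rightarrow> real" where
    \<beta>: "\<And>j. continuous_on UNIV (\<beta> j)" "\<And>j m. 0 \<le> \<beta> j m" "\<And>j. \<beta> j j = 1" "\<And>j m. m \<in> M \<Longrightarrow> m \<noteq> j \<Longrightarrow> \<beta> j m = 0"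
    by blast
  have \<beta>c: "continuous_on K' (\<beta> j)" for j using \<beta>(1) continuous_on_subset by blast
  \<comment> \<open>Almost every direction lies in M, and there any \<phi> is a combination of the
    bumps; its flux is therefore determined by the masses \<open>G d j\<close>.\<close>
  have expand: "\<phi> m = (\<Sum>j\<in>M. \<phi> j * \<beta> j m)" if "m \<in> M" for m and \<phi> :: "real^3 \<Rightarrow> real"
  proof -
    have "(\<Sum>j\<in>M. \<phi> j * \<beta> j m) = (\<Sum>j\<in>M. if j = m then \<phi> j else 0)"
      by (rule sum.cong) (use \<beta>(3) \<beta>(4)[OF that] in auto)
    thus ?thesis using fin that by simp
  qed
  define box where "box d \<longleftrightarrow> d m0 = a' \<and> (\<forall>m\<in>M. 2 * lo \<le> d m)" for d
  define G where "G d j = flux (envelope M d) (\<beta> j)" for d j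
  \<comment> \<open>The feasible set. The cap 4 * a' / \<delta> keeps the free parameters bounded,
    and \<open>m0\<close> is exempt from the limit on the mass received.\<close>
  define W where "W d \<longleftrightarrow> box d \<and> (\<forall>m\<in>M. d m \<le> 4 * a' / \<delta>) \<and> (\<forall>m\<in>M - {m0}. G d m \<le> b m)" for d
  have adm: "admissible lo (a' / \<delta>) (envelope M d)" if "box d" for d
    using envelope_admissible[OF fin ne MK _ m0, of lo d] that lo unfolding box_def by auto
  have AEd: "AE x in surface_measure. x \<in> K \<longrightarrow> single_dir (envelope M d) x \<and> dir (envelope M d) x \<in> M
      \<and> envelope M d x = d (dir (envelope M d) x) / (1 - x \<bullet> dir (envelope M d) x)" if "box d" for d
    using AE_single_dir[OF adm[OF that] lo]
    by eventually_elim (use envelope_dir[OF fin ne MK adm[OF that]] in auto)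
  have fluxG: "flux (envelope M d) \<phi> = (\<Sum>j\<in>M. \<phi> j * G d j)" if "box d" "continuous_on K' \<phi>" for d \<phi>
  proof -
    have "flux (envelope M d) \<phi> = flux (envelope M d) (\<lambda>m. \<Sum>j\<in>M. \<phi> j * \<beta> j m)"
    proof (rule flux_cong_AE[OF adm[OF that(1)] lo that(2)])
      show "continuous_on K' (\<lambda>m. \<Sum>j\<in>M. \<phi> j * \<beta> j m)" by (intro continuous_intros \<beta>c)
      show "AE x in surface_measure. x \<in> K \<longrightarrow> \<phi> (dir (envelope M d) x) = (\<Sum>j\<in>M. \<phi> j * \<beta> j (dir (envelope M d) x))"
        using AEd[OF that(1)] by eventually_elim (use expand in blast)
    qed
    also have "\<dots> = (\<Sum>j\<in>M. flux (envelope M d) (\<lambda>m. \<phi> j * \<beta> j m))"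
      by (rule flux_sum[OF adm[OF that(1)] lo fin]) (intro continuous_intros \<beta>c)
    finally show ?thesis by (simp only: flux_cmult G_def)
  qed
  have G_nonneg: "0 \<le> G d j" if "box d" for d j
  proof -
    have "flux (envelope M d) (\<lambda>_. 0) \<le> flux (envelope M d) (\<beta> j)"
    proof (rule flux_mono_AE[OF adm[OF that] adm[OF that] lo lo])
      show "AE x in surface_measure. x \<in> K \<longrightarrow> weight (envelope M d) x * 0
          \<le> weight (envelope M d) x * \<beta> j (dir (envelope M d) x)"
        by (intro always_eventually allI impI mult_left_mono weight_bounds(1)[OF adm[OF that] lo] \<beta>(2))
    qed (auto intro: \<beta>c)
    thus ?thesis unfolding G_def flux_0 .
  qed
  have G_zero: "G d j = 0" if "box d" "j \<in> M" "\<And>x. x \<in> K \<Longrightarrow> envelope M d x \<noteq> d j / (1 - x \<bullet> j)" for d j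
  proof -
    have "flux (envelope M d) (\<beta> j) = flux (envelope M d) (\<lambda>_. 0)"
    proof (rule flux_cong_AE[OF adm[OF that(1)] lo \<beta>c])
      show "AE x in surface_measure. x \<in> K \<longrightarrow> \<beta> j (dir (envelope M d) x) = 0"
        using AEd[OF that(1)]
      proof eventually_elim
        case (elim x)
        show ?case
        proof
          assume x: "x \<in> K"
          have "dir (envelope M d) x \<noteq> j" using elim x that(3)[OF x] by auto
          thus "\<beta> j (dir (envelope M d) x) = 0" using \<beta>(4) elim x by blast
        qed
      qed
    qed auto
    thus ?thesis unfolding G_def flux_0 .
  qed
  \<comment> \<open>Where j touches the lower envelope, the higher one is squeezed between it and
    the unchanged paraboloid of j. So j touches the higher envelope as well, with the same radius
    and weight: lowering the other parameters only takes mass from j.\<close>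
  have G_mono: "G d' j \<le> G d j" if "box d" "box d'" "\<And>m. m \<in> M \<Longrightarrow> d' m \<le> d m" "j \<in> M" "d' j = d j" for d d' j
    unfolding G_def
  proof (rule flux_mono_AE[OF adm[OF that(2)] adm[OF that(1)] lo lo \<beta>c \<beta>c])
    show "AE x in surface_measure. x \<in> K \<longrightarrow> weight (envelope M d') x * \<beta> j (dir (envelope M d') x)
        \<le> weight (envelope M d) x * \<beta> j (dir (envelope M d) x)"
      using AEd[OF that(1)] AEd[OF that(2)]
    proof eventually_elim
      case (elim x)
      show ?case
      proof
        assume x: "x \<in> K"
        show "weight (envelope M d') x * \<beta> j (dir (envelope M d') x) \<le> weight (envelope M d) x * \<beta> j (dir (envelope M d) x)"
        proof (cases "dir (envelope M d') x = j")
          case True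
          have le: "envelope M d' x \<le> envelope M d x" by (rule envelope_mono[OF fin ne MK that(3) x])
          have "envelope M d x \<le> d j / (1 - x \<bullet> j)" by (rule envelope_le[OF fin ne MK that(4)])
          moreover have "envelope M d' x = d j / (1 - x \<bullet> j)" using elim x True that(5) by auto
          ultimately have eq: "envelope M d x = d j / (1 - x \<bullet> j)" "envelope M d' x = envelope M d x" using le by auto
          have "dir (envelope M d) x = j"
            using dir_eqI[OF adm[OF that(1)] x] envelope_touches[OF fin ne MK that(4) x eq(1)] elim x that(4) MK by blast
          thus ?thesis unfolding weight_def using eq True by simp
        next
          case False
          hence "\<beta> j (dir (envelope M d') x) = 0" using \<beta>(4) elim x by blast
          thus ?thesis using weight_bounds(1)[OF adm[OF that(1)] lo x] \<beta>(2) by simp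
        qed
      qed
    qed
  qed
  have G_tendsto: "(\<lambda>n. G (d n) j) \<longlonglongrightarrow> G l j" if "\<And>n. box (d n)" "box l" "\<And>m. m \<in> M \<Longrightarrow> (\<lambda>n. d n m) \<longlonglongrightarrow> l m" for d l j
    unfolding G_def
    by (rule flux_tendsto[OF adm[OF that(1)] adm[OF that(2)] lo \<beta>c]) (rule envelope_tendsto[OF fin ne MK that(3)])
  have total_le: "sum b M \<le> (\<Sum>j\<in>M. G d j)" if "box d" for d
  proof -
    \<comment> \<open>The constant of the mass condition is the lower bound of the weight for hi =
      a' / \<delta>.\<close>
    have "\<delta>^3 / (2 * a'\<^sup>2) = \<delta> / (2 * (a' / \<delta>)\<^sup>2)"
      using \<delta>_pos a' by (simp add: power2_eq_square power3_eq_cube)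
    hence "sum b M \<le> \<delta> / (2 * (a' / \<delta>)\<^sup>2) * (LINT x:K|surface_measure. f x)" using total by simp
    also have "\<dots> \<le> flux (envelope M d) (\<lambda>_. 1)" by (rule flux_total_ge[OF adm[OF that] lo \<delta>1])
    also have "\<dots> = (\<Sum>j\<in>M. G d j)" using fluxG[OF that, of "\<lambda>_. 1"] by simp
    finally show ?thesis .
  qed
  \<comment> \<open>If d i is smaller, the paraboloid of i has radius at most d i / \<delta> < a' /
    2, while that of \<open>m0\<close> has radius at least a' / 2, so \<open>m0\<close> receives
    nothing. The capped masses of the others then fall short of the required total by at least
    \<open>b m0\<close>, which is positive.\<close>
  have far: "\<delta> * a' / 2 \<le> d i" if W: "W d" and i: "i \<in> M" for d i
  proof (rule ccontr)
    assume "\<not> \<delta> * a' / 2 \<le> d i"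
    hence small: "d i < \<delta> * a' / 2" by simp
    have box: "box d" using W unfolding W_def by blast
    have di: "0 \<le> d i" using box i lo unfolding box_def by fastforce
    have "G d m0 = 0"
    proof (rule G_zero[OF box m0])
      fix x assume x: "x \<in> K"
      have "envelope M d x \<le> d i / (1 - x \<bullet> i)" by (rule envelope_le[OF fin ne MK i])
      also have "\<dots> \<le> d i / \<delta>" using one_minus_ge[OF x, of i] i MK \<delta>_pos di by (intro frac_le) auto
      also have "\<dots> < a' / 2" using small \<delta>_pos by (simp add: field_simps)
      also have "\<dots> \<le> a' / (1 - x \<bullet> m0)"
        using one_minus_le[OF x, of m0] one_minus_ge[OF x, of m0] m0 MK \<delta>_pos a' by (intro frac_le) auto
      finally show "envelope M d x \<noteq> d m0 / (1 - x \<bullet> m0)" using box unfolding box_def by simp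
    qed
    hence "(\<Sum>j\<in>M. G d j) = (\<Sum>j\<in>M - {m0}. G d j)" using fin m0 by (simp add: sum.remove)
    also have "\<dots> \<le> sum b (M - {m0})" using W unfolding W_def by (intro sum_mono) auto
    also have "\<dots> < sum b M" using fin m0 b(2) by (simp add: sum.remove)
    finally show False using total_le[OF box] by simp
  qed
  \<comment> \<open>A feasible starting point: with parameter 4 * a' / \<delta> a paraboloid has
    radius at least 2 * a' / \<delta>, beyond the bound a' / \<delta> of the envelope, so only
    \<open>m0\<close> receives mass.\<close>
  let ?d0 = "\<lambda>m. if m = m0 then a' else 4 * a' / \<delta>"
  have "W ?d0"
  proof -
    have *: "a' \<le> 4 * a' / \<delta>" "2 * lo \<le> a'"
      using \<delta>1 \<delta>_pos a' by (auto simp: lo_def field_simps intro: mult_left_le order_trans)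
    hence box: "box ?d0" unfolding box_def by auto
    have "G ?d0 m = 0" if m: "m \<in> M" "m \<noteq> m0" for m
    proof (rule G_zero[OF box m(1)])
      fix x assume x: "x \<in> K"
      have "envelope M ?d0 x \<le> a' / \<delta>" using adm[OF box] x unfolding admissible_def by blast
      also have "\<dots> < (4 * a' / \<delta>) / 2" using a' \<delta>_pos by (simp add: field_simps)
      also have "\<dots> \<le> (4 * a' / \<delta>) / (1 - x \<bullet> m)"
        using one_minus_le[OF x, of m] one_minus_ge[OF x, of m] m MK \<delta>_pos a' by (intro frac_le) auto
      finally show "envelope M ?d0 x \<noteq> ?d0 m / (1 - x \<bullet> m)" using m by simp
    qed
    thus ?thesis unfolding W_def using box * b by auto
  qed
  have W_nonneg: "0 \<le> sum d M" if "W d" for d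
    using that lo unfolding W_def box_def by (intro sum_nonneg) fastforce
  \<comment> \<open>The infimum is attained: bounded parameters have a convergent subsequence, and
    the constraints survive the limit because G is continuous in the parameters.\<close>
  let ?S = "{sum d M | d. W d}"
  have bdd: "bdd_below ?S" using W_nonneg by (intro bdd_belowI[of _ 0]) auto
  have S_ne: "?S \<noteq> {}" using \<open>W ?d0\<close> by blast
  have "\<exists>d. W d \<and> sum d M < Inf ?S + 1 / real (Suc n)" for n
    using cInf_lessD[OF S_ne, of "Inf ?S + 1 / real (Suc n)"] by auto
  hence "\<forall>n. \<exists>d. W d \<and> sum d M < Inf ?S + 1 / real (Suc n)" by blast
  from choice[OF this] obtain D where D: "\<And>n. W (D n)" "\<And>n. sum (D n) M < Inf ?S + 1 / real (Suc n)" by blast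
  have D_bound: "\<bar>D n m\<bar> \<le> 4 * a' / \<delta>" if "m \<in> M" for n m
    using D(1)[of n] that lo unfolding W_def box_def by fastforce
  obtain r l where r: "strict_mono (r :: nat \<Rightarrow> nat)" "\<And>m. m \<in> M \<Longrightarrow> (\<lambda>n. D (r n) m) \<longlonglongrightarrow> l m"
    using finite_bounded_convergent_subsequence[of M D, OF fin D_bound] by blast
  have boxD: "box (D n)" for n using D(1) unfolding W_def by blast
  have boxl: "box l"
    unfolding box_def
  proof (intro conjI ballI)
    show "l m0 = a'" using LIMSEQ_unique[OF r(2)[OF m0]] boxD unfolding box_def by simp
    show "2 * lo \<le> l m" if "m \<in> M" for m
      by (rule LIMSEQ_le_const[OF r(2)[OF that]]) (use boxD that in \<open>auto simp: box_def\<close>)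
  qed
  have Wl: "W l"
    unfolding W_def
  proof (intro conjI ballI boxl)
    show "l m \<le> 4 * a' / \<delta>" if "m \<in> M" for m
      by (rule LIMSEQ_le_const2[OF r(2)[OF that]]) (use D(1) that in \<open>auto simp: W_def\<close>)
    show "G l m \<le> b m" if "m \<in> M - {m0}" for m
      by (rule LIMSEQ_le_const2[OF G_tendsto[OF boxD boxl r(2)]]) (use D(1) that in \<open>auto simp: W_def\<close>)
  qed
  have minimal: "sum l M \<le> sum d M" if "W d" for d
  proof -
    have "(\<lambda>n. sum (D (r n)) M) \<longlonglongrightarrow> sum l M" by (intro tendsto_sum r(2))
    moreover have "(\<lambda>n. Inf ?S + 1 / real (Suc n)) \<longlonglongrightarrow> Inf ?S + 0"
      by (intro tendsto_intros LIMSEQ_Suc[OF lim_1_over_n])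
    hence "(\<lambda>n. Inf ?S + 1 / real (Suc (r n))) \<longlonglongrightarrow> Inf ?S"
      using LIMSEQ_subseq_LIMSEQ[OF _ r(1)] by (fastforce simp: o_def)
    ultimately have "sum l M \<le> Inf ?S" by (rule LIMSEQ_le) (use D(2) less_imp_le in blast)
    also have "\<dots> \<le> sum d M" using that by (intro cInf_lower bdd) auto
    finally show ?thesis .
  qed
  have G_eq: "G l i = b i" if i: "i \<in> M" "i \<noteq> m0" for i
  proof (rule ccontr)
    assume "G l i \<noteq> b i"
    moreover have "G l i \<le> b i" using Wl i unfolding W_def by blast
    ultimately have less: "G l i < b i" by simp
    \<comment> \<open>Only the parameter of i is lowered, by a vanishing amount. Its mass stays
      below \<open>b i\<close> by continuity and the other constrained masses cannot grow, yet the
      sum drops. Since i differs from \<open>m0\<close>, the value a' at \<open>m0\<close> is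
      kept.\<close>
    define d where "d n = l(i := l i - lo / real (Suc n))" for n
    have li: "4 * lo \<le> l i" using far[OF Wl i(1)] unfolding lo_def by simp
    have "lo / real (Suc n) \<le> lo" for n using lo by (simp add: field_simps)
    hence boxd: "box (d n)" for n using boxl i li lo unfolding box_def d_def by (auto, smt (verit))
    have "(\<lambda>n. l i - lo / real (Suc n)) \<longlonglongrightarrow> l i - 0"
      by (intro tendsto_intros LIMSEQ_Suc[OF lim_const_over_n])
    hence "(\<lambda>n. d n m) \<longlonglongrightarrow> l m" for m unfolding d_def by (cases "m = i") auto
    from G_tendsto[OF boxd boxl this] have "(\<lambda>n. G (d n) i) \<longlonglongrightarrow> G l i" .
    from order_tendstoD(2)[OF this less] obtain n where n: "G (d n) i < b i"
      by (auto simp: eventually_sequentially)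
    have le: "d n m \<le> l m" for m unfolding d_def using lo by auto
    have "W (d n)"
      unfolding W_def
    proof (intro conjI ballI boxd)
      show "d n m \<le> 4 * a' / \<delta>" if "m \<in> M" for m
        by (rule order_trans[OF le]) (use Wl that in \<open>auto simp: W_def\<close>)
      show "G (d n) m \<le> b m" if m: "m \<in> M - {m0}" for m
      proof (cases "m = i")
        case False
        hence "G (d n) m \<le> G l m" using m by (intro G_mono[OF boxl boxd le]) (auto simp: d_def)
        moreover have "G l m \<le> b m" using Wl m unfolding W_def by blast
        ultimately show ?thesis by simp
      qed (use n in auto)
    qed
    from minimal[OF this] have "sum l M \<le> sum (d n) M" .
    moreover have "sum (d n) M < sum l M"
      using i lo by (intro sum_strict_mono_ex1[OF fin]) (auto simp: d_def)
    ultimately show False by simp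
  qed
  define \<rho> where "\<rho> = envelope M l"
  have touch: "\<exists>m\<in>K'. touches K \<rho> m x \<and> \<delta> * a' / 2 \<le> \<rho> x * (1 - x \<bullet> m)" if x: "x \<in> K" for x
  proof -
    obtain m where m: "m \<in> M" "\<rho> x = l m / (1 - x \<bullet> m)"
      using envelope_attained[OF fin ne MK] unfolding \<rho>_def by blast
    have "0 < 1 - x \<bullet> m" using one_minus_ge[OF x, of m] m MK \<delta>_pos by auto
    hence "\<rho> x * (1 - x \<bullet> m) = l m" using m by simp
    thus ?thesis using envelope_touches[OF fin ne MK m(1) x] far[OF Wl m(1)] m MK unfolding \<rho>_def by fastforce
  qed
  \<comment> \<open>The bound from \<open>far\<close> replaces 2 * lo by 4 * lo, which doubles the
    lower bound for \<rho>.\<close>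
  have "admissible (\<delta> * a' / 4) (a' / \<delta>) \<rho>"
    using envelope_admissible[OF fin ne MK _ m0, of "\<delta> * a' / 4" l] far[OF Wl] boxl \<delta>_pos a'
    unfolding \<rho>_def box_def by auto
  \<comment> \<open>The other directions receive exactly their shares, so the inequality between the
    totals leaves at least \<open>b m0\<close> for \<open>m0\<close>.\<close>
  moreover have "b m0 \<le> G l m0"
  proof -
    have "(\<Sum>j\<in>M - {m0}. G l j) = sum b (M - {m0})" by (rule sum.cong) (use G_eq in auto)
    thus ?thesis using total_le[OF boxl] fin m0 by (simp add: sum.remove)
  qed
  moreover have "flux \<rho> \<phi> = (\<Sum>m\<in>M. b m * \<phi> m) + (G l m0 - b m0) * \<phi> m0" if "continuous_on K' \<phi>" for \<phi>
  proof -
    have "(\<Sum>j\<in>M - {m0}. \<phi> j * G l j) = (\<Sum>m\<in>M - {m0}. b m * \<phi> m)" by (rule sum.cong) (use G_eq in auto)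
    thus ?thesis using fluxG[OF boxl that] fin m0 unfolding \<rho>_def by (simp add: sum.remove algebra_simps)
  qed
  ultimately show ?thesis using touch by (intro exI[of _ \<rho>] exI[of _ "G l m0 - b m0"]) auto
qed

end

section \<open>General target measures\<close>

text \<open>Testing finitely many candidates one after another gives a Borel choice; m0 is the
  default value where no candidate is near.\<close>

lemma measurable_nearby_selection:
  fixes m0 :: "'a::{metric_space, second_countable_topology}"
  assumes "finite C"
  shows "\<exists>q. q \<in> borel_measurable borel \<and> (\<forall>m. q m \<in> insert m0 C) \<and> (\<forall>m. (\<exists>c\<in>C. dist c m < e) \<longrightarrow> dist (q m) m < e)"
  using assms
proof (induction C rule: finite_induct)
  case empty
  show ?case by (intro exI[of _ "\<lambda>_. m0"]) auto
next
  case (insert c C)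
  then obtain q where q: "q \<in> borel_measurable borel" "\<And>m. q m \<in> insert m0 C"
    "\<And>m. (\<exists>c\<in>C. dist c m < e) \<Longrightarrow> dist (q m) m < e" by blast
  have "(\<lambda>m. if dist c m < e then c else q m) \<in> borel_measurable borel"
    using q(1) by measurable
  thus ?case using q(2,3) by (intro exI[of _ "\<lambda>m. if dist c m < e then c else q m"]) auto
qed

text \<open>Rounding to a finite net. A whole ball is sent to m0, so that m0 receives a positive
  point mass when it lies in the support, as the discrete problem requires.\<close>

lemma compact_quantizer:
  fixes K :: "'a::{metric_space, second_countable_topology} set"
  assumes K: "compact K" and m0: "m0 \<in> K" and e: "0 < e"
  shows "\<exists>q M. finite M \<and> M \<subseteq> K \<and> m0 \<in> M \<and> q \<in> borel_measurable borel \<and> (\<forall>m. q m \<in> M)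
    \<and> (\<forall>m\<in>K. dist (q m) m < e) \<and> (\<forall>m. dist m0 m < e \<longrightarrow> q m = m0)"
proof -
  obtain C where C: "finite C" "C \<subseteq> K" "K \<subseteq> (\<Union>c\<in>C. ball c e)"
    by (rule compactE_image[OF K, of K "\<lambda>c. ball c e"]) (use e in auto)
  obtain q where q: "q \<in> borel_measurable borel" "\<And>m. q m \<in> insert m0 C"
    "\<And>m. (\<exists>c\<in>C. dist c m < e) \<Longrightarrow> dist (q m) m < e"
    using measurable_nearby_selection[OF C(1), of m0 e] by blast
  have "(\<lambda>m. if dist m0 m < e then m0 else q m) \<in> borel_measurable borel"
    using q(1) by measurable
  moreover have "dist (q m) m < e" if "m \<in> K" for m using that C(3) q(3) by (auto simp: subset_iff)
  ultimately show ?thesis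
    using C m0 q(2)
    by (intro exI[of _ "\<lambda>m. if dist m0 m < e then m0 else q m"] exI[of _ "insert m0 C"]) auto
qed

context flux_setup
begin

lemma borel_measurable_continuous_on_K':
  assumes "sets \<eta> = sets (restrict_space borel K')" "continuous_on K' (\<phi> :: real^3 \<Rightarrow> real)"
  shows "\<phi> \<in> borel_measurable \<eta>"
  using borel_measurable_continuous_on_restrict[OF assms(2)] measurable_cong_sets[OF assms(1) refl] by blast

text \<open>The measure \<eta> is replaced by its images under rounding maps converging to the
  identity. Convergence of the surpluses comes from testing with the constant 1, which writes them
  as the difference of two convergent sequences.\<close>

lemma reflector_exists_test_functions:
  assumes sets_\<eta>: "sets \<eta> = sets (restrict_space borel K')" and fin_\<eta>: "finite_measure \<eta>"
    and m0: "m0 \<in> K'" and supp: "\<And>e. 0 < e \<Longrightarrow> 0 < measure \<eta> (ball m0 e \<inter> K')"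
    and \<delta>1: "\<delta> \<le> 1" and a': "0 < a'"
    and total: "measure \<eta> K' \<le> \<delta>^3 / (2 * a'\<^sup>2) * (LINT x:K|surface_measure. f x)"
  shows "\<exists>\<rho> c. admissible (\<delta> * a' / 4) (a' / \<delta>) \<rho> \<and> 0 \<le> c
    \<and> (\<forall>x\<in>K. \<exists>m\<in>K'. touches K \<rho> m x \<and> \<delta> * a' / 2 \<le> \<rho> x * (1 - x \<bullet> m))
    \<and> (\<forall>\<phi>. continuous_on K' \<phi> \<longrightarrow> flux \<rho> \<phi> = (LINT m|\<eta>. \<phi> m) + c * \<phi> m0)"
proof -
  interpret \<eta>: finite_measure \<eta> by fact
  define lo where "lo = \<delta> * a' / 4"
  have lo: "0 < lo" unfolding lo_def using \<delta>_pos a' by simp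
  have space_\<eta>: "space \<eta> = K'" using sets_eq_imp_space_eq[OF sets_\<eta>] by (simp add: space_restrict_space)
  have sets_Int: "E \<inter> K' \<in> sets \<eta>" if "E \<in> sets borel" for E
    unfolding sets_\<eta> sets_restrict_space using that by (auto simp: Int_commute)
  have "\<forall>n. \<exists>q M. finite M \<and> M \<subseteq> K' \<and> m0 \<in> M \<and> q \<in> borel_measurable borel \<and> (\<forall>m. q m \<in> M)
    \<and> (\<forall>m\<in>K'. dist (q m) m < 1 / real (Suc n)) \<and> (\<forall>m. dist m0 m < 1 / real (Suc n) \<longrightarrow> q m = m0)"
    by (intro allI compact_quantizer compact_K' m0) simp
  from choice[OF this] obtain q where "\<forall>n. \<exists>M. finite M \<and> M \<subseteq> K' \<and> m0 \<in> M \<and> q n \<in> borel_measurable borel \<and> (\<forall>m. q n m \<in> M)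
    \<and> (\<forall>m\<in>K'. dist (q n m) m < 1 / real (Suc n)) \<and> (\<forall>m. dist m0 m < 1 / real (Suc n) \<longrightarrow> q n m = m0)"
    by blast
  from choice[OF this] obtain M where M: "\<And>n. finite (M n)" "\<And>n. M n \<subseteq> K'" "\<And>n. m0 \<in> M n"
    and q: "\<And>n. q n \<in> borel_measurable borel" "\<And>n m. q n m \<in> M n"
      "\<And>n m. m \<in> K' \<Longrightarrow> dist (q n m) m < 1 / real (Suc n)" "\<And>n m. dist m0 m < 1 / real (Suc n) \<Longrightarrow> q n m = m0"
    by blast
  \<comment> \<open>The point masses of the image of \<eta> under \<open>q n\<close>;
    \<open>sum_b\<close> is the corresponding change of variables.\<close>
  define b where "b n j = measure \<eta> (q n -` {j} \<inter> K')" for n j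
  have cell: "q n -` {j} \<inter> K' \<in> sets \<eta>" for n j
    by (rule sets_Int) (use measurable_sets[OF q(1), of "{j}" n] in auto)
  have sum_b: "(\<Sum>j\<in>M n. b n j * \<phi> j) = (LINT m|\<eta>. \<phi> (q n m))" for n \<phi>
  proof -
    have "(LINT m|\<eta>. \<phi> (q n m)) = (LINT m|\<eta>. (\<Sum>j\<in>M n. indicator (q n -` {j} \<inter> K') m * \<phi> j))"
    proof (rule Bochner_Integration.integral_cong[OF refl])
      fix m assume "m \<in> space \<eta>"
      hence "(\<Sum>j\<in>M n. indicator (q n -` {j} \<inter> K') m * \<phi> j) = (\<Sum>j\<in>M n. if j = q n m then \<phi> j else 0)"
        by (intro sum.cong) (auto simp: space_\<eta>)
      thus "\<phi> (q n m) = (\<Sum>j\<in>M n. indicator (q n -` {j} \<inter> K') m * \<phi> j)" using M(1) q(2) by simp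
    qed
    also have "\<dots> = (\<Sum>j\<in>M n. b n j * \<phi> j)"
      unfolding b_def using cell by (subst Bochner_Integration.integral_sum) (auto simp: \<eta>.emeasure_finite less_top[symmetric] space_\<eta> Int_assoc)
    finally show ?thesis by simp
  qed
  have "0 < b n m0" for n
  proof -
    have "measure \<eta> (ball m0 (1 / real (Suc n)) \<inter> K') \<le> b n m0"
      unfolding b_def by (rule \<eta>.finite_measure_mono[OF _ cell]) (use q(4) in auto)
    thus ?thesis using supp[of "1 / real (Suc n)"] by simp
  qed
  moreover have "sum (b n) (M n) \<le> \<delta>^3 / (2 * a'\<^sup>2) * (LINT x:K|surface_measure. f x)" for n
    using sum_b[of n "\<lambda>_. 1"] total by (simp add: space_\<eta>)
  moreover have "0 \<le> b n j" for n j unfolding b_def by simp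
  ultimately have "\<forall>n. \<exists>\<rho> c. admissible lo (a' / \<delta>) \<rho> \<and> 0 \<le> c
    \<and> (\<forall>x\<in>K. \<exists>m\<in>K'. touches K \<rho> m x \<and> \<delta> * a' / 2 \<le> \<rho> x * (1 - x \<bullet> m))
    \<and> (\<forall>\<phi>. continuous_on K' \<phi> \<longrightarrow> flux \<rho> \<phi> = (\<Sum>m\<in>M n. b n m * \<phi> m) + c * \<phi> m0)"
    unfolding lo_def by (intro allI discrete_reflector_exists M \<delta>1 a')
  from choice[OF this] obtain \<rho>s where "\<forall>n. \<exists>c. admissible lo (a' / \<delta>) (\<rho>s n) \<and> 0 \<le> c
    \<and> (\<forall>x\<in>K. \<exists>m\<in>K'. touches K (\<rho>s n) m x \<and> \<delta> * a' / 2 \<le> \<rho>s n x * (1 - x \<bullet> m))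
    \<and> (\<forall>\<phi>. continuous_on K' \<phi> \<longrightarrow> flux (\<rho>s n) \<phi> = (\<Sum>m\<in>M n. b n m * \<phi> m) + c * \<phi> m0)" by blast
  from choice[OF this] obtain cs where \<rho>s: "\<And>n. admissible lo (a' / \<delta>) (\<rho>s n)" and cs: "\<And>n. 0 \<le> cs n"
    and touch: "\<And>n x. x \<in> K \<Longrightarrow> \<exists>m\<in>K'. touches K (\<rho>s n) m x \<and> \<delta> * a' / 2 \<le> \<rho>s n x * (1 - x \<bullet> m)"
    and fl: "\<And>n \<phi>. continuous_on K' \<phi> \<Longrightarrow> flux (\<rho>s n) \<phi> = (\<Sum>m\<in>M n. b n m * \<phi> m) + cs n * \<phi> m0"
    by blast
  obtain g k where k: "strict_mono (k :: nat \<Rightarrow> nat)"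
    and g: "\<And>e. 0 < e \<Longrightarrow> \<exists>N. \<forall>n x. n \<ge> N \<and> x \<in> K \<longrightarrow> norm (\<rho>s (k n) x - g x) < e"
  proof (rule Arzela_Ascoli[OF compact_K, of \<rho>s "a' / \<delta>"])
    show "norm (\<rho>s n x) \<le> a' / \<delta>" if "x \<in> K" for n x
      using \<rho>s[of n] that lo unfolding admissible_def by fastforce
    show "\<exists>d>0. \<forall>n y. y \<in> K \<and> norm (x - y) < d \<longrightarrow> norm (\<rho>s n x - \<rho>s n y) < e" if x: "x \<in> K" and e: "0 < e" for x e
    proof (intro exI conjI allI impI; (elim conjE)?)
      have L: "0 < a' / \<delta> / \<delta>" using a' \<delta>_pos by simp
      show "0 < e / (a' / \<delta> / \<delta>)" using e L by (rule divide_pos_pos)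
      fix n y assume y: "y \<in> K" "norm (x - y) < e / (a' / \<delta> / \<delta>)"
      have "norm (\<rho>s n x - \<rho>s n y) \<le> a' / \<delta> / \<delta> * norm (x - y)"
        using admissible_lipschitz[OF \<rho>s lo x y(1)] by simp
      also have "\<dots> < e" using y(2) L by (simp only: pos_less_divide_eq mult.commute)
      finally show "norm (\<rho>s n x - \<rho>s n y) < e" .
    qed
  qed blast
  have lim: "(\<lambda>n. \<rho>s (k n) x) \<longlonglongrightarrow> g x" if "x \<in> K" for x
    using g that unfolding LIMSEQ_iff by blast
  \<comment> \<open>Touching directions at a fixed x need not converge, but a subsequence does in
    the compact K'. Its limit inherits both the touching and the bound on the parameter.\<close>
  have touch_g: "\<exists>m\<in>K'. touches K g m x \<and> \<delta> * a' / 2 \<le> g x * (1 - x \<bullet> m)" if x: "x \<in> K" for x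
  proof -
    have "\<forall>n. \<exists>m. m \<in> K' \<and> touches K (\<rho>s (k n)) m x \<and> \<delta> * a' / 2 \<le> \<rho>s (k n) x * (1 - x \<bullet> m)"
      using touch[OF x] by blast
    from choice[OF this] obtain m where m: "\<And>n. m n \<in> K'" "\<And>n. touches K (\<rho>s (k n)) (m n) x"
      "\<And>n. \<delta> * a' / 2 \<le> \<rho>s (k n) x * (1 - x \<bullet> m n)" by blast
    obtain l s where s: "l \<in> K'" "strict_mono (s :: nat \<Rightarrow> nat)" "(m \<circ> s) \<longlonglongrightarrow> l"
      using compact_K' m(1) unfolding compact_def by meson
    note sub = LIMSEQ_subseq_LIMSEQ[OF lim s(2), unfolded o_def]
    have ml: "(\<lambda>n. m (s n)) \<longlonglongrightarrow> l" using s(3) by (simp add: o_def)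
    have "touches K g l x"
      by (rule touches_limit[where \<rho>s="\<lambda>n. \<rho>s (k (s n))" and x="\<lambda>_. x" and m="\<lambda>n. m (s n)"])
        (use sub x ml m in auto)
    moreover have "(\<lambda>n. \<rho>s (k (s n)) x * (1 - x \<bullet> m (s n))) \<longlonglongrightarrow> g x * (1 - x \<bullet> l)"
      by (intro tendsto_intros sub x ml)
    hence "\<delta> * a' / 2 \<le> g x * (1 - x \<bullet> l)" by (rule LIMSEQ_le_const) (use m in auto)
    ultimately show ?thesis using s by blast
  qed
  have adm: "admissible lo (a' / \<delta>) g"
    unfolding admissible_def
  proof (intro conjI ballI)
    fix x assume x: "x \<in> K"
    show "lo \<le> g x" by (rule LIMSEQ_le_const[OF lim[OF x]]) (use \<rho>s x in \<open>auto simp: admissible_def\<close>)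
    show "g x \<le> a' / \<delta>" by (rule LIMSEQ_le_const2[OF lim[OF x]]) (use \<rho>s x in \<open>auto simp: admissible_def\<close>)
    show "\<exists>m\<in>K'. touches K g m x" using touch_g[OF x] by blast
  qed
  have flux_lim: "(\<lambda>n. flux (\<rho>s (k n)) \<phi>) \<longlonglongrightarrow> flux g \<phi>" if "continuous_on K' \<phi>" for \<phi>
    by (rule flux_tendsto[OF \<rho>s adm lo that lim])
  have int_lim: "(\<lambda>n. \<Sum>m\<in>M (k n). b (k n) m * \<phi> m) \<longlonglongrightarrow> (LINT m|\<eta>. \<phi> m)" if \<phi>: "continuous_on K' \<phi>" for \<phi>
  proof -
    obtain B where B: "\<And>m. m \<in> K' \<Longrightarrow> \<bar>\<phi> m\<bar> \<le> B"
      using compact_imp_bounded[OF compact_continuous_image[OF \<phi> compact_K']] unfolding bounded_iff by auto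
    have qK: "q n m \<in> K'" for n m using q(2) M(2) by blast
    have "(\<lambda>n. LINT m|\<eta>. \<phi> (q n m)) \<longlonglongrightarrow> (LINT m|\<eta>. \<phi> m)"
    proof (rule integral_dominated_convergence[where w="\<lambda>_. B"])
      show "\<phi> \<in> borel_measurable \<eta>" by (rule borel_measurable_continuous_on_K'[OF sets_\<eta> \<phi>])
      show "(\<lambda>m. \<phi> (q n m)) \<in> borel_measurable \<eta>" for n
      proof -
        have "q n \<in> \<eta> \<rightarrow>\<^sub>M restrict_space borel K'"
        proof (rule measurable_restrict_space2)
          show "q n \<in> borel_measurable \<eta>"
            using measurable_restrict_space1[OF q(1)] measurable_cong_sets[OF sets_\<eta> refl] by blast
        qed (use qK in auto)
        from measurable_compose[OF this borel_measurable_continuous_on_restrict[OF \<phi>]] show ?thesis .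
      qed
      show "AE m in \<eta>. (\<lambda>n. \<phi> (q n m)) \<longlonglongrightarrow> \<phi> m"
      proof (rule AE_I2)
        fix m assume "m \<in> space \<eta>"
        hence m: "m \<in> K'" by (simp add: space_\<eta>)
        have "(\<lambda>n. dist (q n m) m) \<longlonglongrightarrow> 0"
          by (rule tendsto_sandwich[OF _ _ tendsto_const LIMSEQ_Suc[OF lim_1_over_n]])
            (intro always_eventually allI zero_le_dist less_imp_le[OF q(3)[OF m]])+
        hence "(\<lambda>n. q n m) \<longlonglongrightarrow> m" by (rule tendsto_dist_iff[THEN iffD2])
        thus "(\<lambda>n. \<phi> (q n m)) \<longlonglongrightarrow> \<phi> m"
          by (rule continuous_on_tendsto_compose[OF \<phi>]) (use m qK in auto)
      qed
      show "AE m in \<eta>. norm (\<phi> (q n m)) \<le> B" for n using B qK by simp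
    qed simp
    hence "(\<lambda>n. \<Sum>m\<in>M n. b n m * \<phi> m) \<longlonglongrightarrow> (LINT m|\<eta>. \<phi> m)" by (simp only: sum_b)
    from LIMSEQ_subseq_LIMSEQ[OF this k] show ?thesis by (simp only: o_def)
  qed
  define c where "c = flux g (\<lambda>_. 1) - (LINT m|\<eta>. 1)"
  have c: "(\<lambda>n. cs (k n)) \<longlonglongrightarrow> c"
  proof -
    have "(\<lambda>n. flux (\<rho>s (k n)) (\<lambda>_. 1) - (\<Sum>m\<in>M (k n). b (k n) m * 1)) \<longlonglongrightarrow> c"
      unfolding c_def by (intro tendsto_diff flux_lim int_lim continuous_intros)
    moreover have "flux (\<rho>s (k n)) (\<lambda>_. 1) - (\<Sum>m\<in>M (k n). b (k n) m * 1) = cs (k n)" for n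
      using fl[of "\<lambda>_. 1" "k n"] by simp
    ultimately show ?thesis by (simp only:)
  qed
  have c0: "0 \<le> c" by (rule LIMSEQ_le_const[OF c]) (use cs in auto)
  have "flux g \<phi> = (LINT m|\<eta>. \<phi> m) + c * \<phi> m0" if \<phi>: "continuous_on K' \<phi>" for \<phi>
  proof (rule LIMSEQ_unique[OF flux_lim[OF \<phi>]])
    show "(\<lambda>n. flux (\<rho>s (k n)) \<phi>) \<longlonglongrightarrow> (LINT m|\<eta>. \<phi> m) + c * \<phi> m0"
      unfolding fl[OF \<phi>] by (intro tendsto_intros int_lim[OF \<phi>] c)
  qed
  thus ?thesis
    using adm touch_g c0 unfolding lo_def by (intro exI[of _ g] exI[of _ c] conjI ballI allI impI) auto
qed

section \<open>From continuous test functions to Borel sets\<close>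

lemma dir_vimage_sets:
  assumes adm: "admissible lo hi \<rho>" and lo: "0 < lo" and E: "E \<in> sets borel"
  shows "{x \<in> K. dir \<rho> x \<in> E} \<in> sets surface_measure"
proof -
  have "(\<lambda>x. indicator K x *\<^sub>R dir \<rho> x) \<in> borel_measurable surface_measure"
  proof (rule surface_measurable_if_continuous_on[OF _ _ K_sets continuous_on_dir[OF adm lo]])
    have "K - {x \<in> K. single_dir \<rho> x} = {x \<in> K. \<not> single_dir \<rho> x}" by auto
    thus "K - {x \<in> K. single_dir \<rho> x} \<in> null_sets surface_measure"
      using null_set_not_single_dir[OF adm lo] by simp
  qed auto
  from sets.Int[OF measurable_sets[OF this E] K_sets]
  have "(\<lambda>x. indicator K x *\<^sub>R dir \<rho> x) -` E \<inter> space surface_measure \<inter> K \<in> sets surface_measure" .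
  moreover have "(\<lambda>x. indicator K x *\<^sub>R dir \<rho> x) -` E \<inter> space surface_measure \<inter> K = {x \<in> K. dir \<rho> x \<in> E}"
    using K_subset by auto
  ultimately show ?thesis by simp
qed

lemma weighted_integrable:
  assumes adm: "admissible lo hi \<rho>" and lo: "0 < lo" and E: "E \<in> sets borel"
  shows "set_integrable surface_measure {x \<in> K. dir \<rho> x \<in> E} (\<lambda>x. f x * weight \<rho> x)"
  by (rule set_integrable_subset[OF _ dir_vimage_sets[OF assms]])
    (use flux_integrable[OF adm lo, of "\<lambda>_. 1"] in auto)

text \<open>For a closed set, continuous cutoffs of the distance converge to the indicator, and
  dominated convergence applies on both sides. Closed sets are stable under intersection and
  generate the Borel sets, and both sides are finite and countably additive, so a Dynkin argument
  gives the rest.\<close>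

lemma flux_measure_eq:
  assumes adm: "admissible lo hi \<rho>" and lo: "0 < lo"
    and sets_\<eta>: "sets \<eta> = sets (restrict_space borel K')" and fin_\<eta>: "finite_measure \<eta>"
    and tested: "\<And>\<phi>. continuous_on K' \<phi> \<Longrightarrow> flux \<rho> \<phi> = (LINT m|\<eta>. \<phi> m) + c * \<phi> m0"
    and E: "E \<in> sets borel"
  shows "(LINT x:{x \<in> K. dir \<rho> x \<in> E}|surface_measure. f x * weight \<rho> x) = measure \<eta> (E \<inter> K') + c * indicator E m0"
proof -
  interpret \<eta>: finite_measure \<eta> by fact
  have space_\<eta>: "space \<eta> = K'" using sets_eq_imp_space_eq[OF sets_\<eta>] by (simp add: space_restrict_space)
  have sets_Int: "E \<inter> K' \<in> sets \<eta>" if "E \<in> sets borel" for E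
    unfolding sets_\<eta> sets_restrict_space using that by (auto simp: Int_commute)
  define N where "N E = (LINT x:{x \<in> K. dir \<rho> x \<in> E}|surface_measure. f x * weight \<rho> x)" for E
  define h where "h x = indicator K x *\<^sub>R (f x * weight \<rho> x)" for x
  have h: "integrable surface_measure h"
    using flux_integrable[OF adm lo, of "\<lambda>_. 1"] unfolding set_integrable_def h_def by simp
  note wi = weighted_integrable[OF adm lo]
  have N_h: "N E = (LINT x|surface_measure. h x * indicator E (dir \<rho> x))" for E
    unfolding N_def set_lebesgue_integral_def h_def
    by (rule Bochner_Integration.integral_cong[OF refl]) (auto simp: indicator_def)
  have flux_h: "flux \<rho> \<phi> = (LINT x|surface_measure. h x * \<phi> (dir \<rho> x))" for \<phi>
    unfolding flux_def set_lebesgue_integral_def h_def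
    by (rule Bochner_Integration.integral_cong[OF refl]) (auto simp: indicator_def)
  have N_UNIV: "N UNIV = measure \<eta> K' + c"
    using tested[of "\<lambda>_. 1"] flux_h[of "\<lambda>_. 1"] N_h[of UNIV] by (simp add: space_\<eta>)
  have closed: "N F = measure \<eta> (F \<inter> K') + c * indicator F m0" if F: "closed F" for F
  \<comment> \<open>By convention \<open>infdist\<close> to the empty set is 0, which would make the
    cutoffs constantly 1; the empty set is treated apart.\<close>
  proof (cases "F = {}")
    case True thus ?thesis unfolding N_h by simp
  next
    case False
    define \<phi> where "\<phi> n m = max 0 (1 - real n * infdist m F)" for n m
    have \<phi>c: "continuous_on S (\<phi> n)" for n S unfolding \<phi>_def by (intro continuous_intros)
    have \<phi>01: "\<bar>\<phi> n m\<bar> \<le> 1" for n m unfolding \<phi>_def using infdist_nonneg[of m F] by (auto simp: max_def)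
    have \<phi>lim: "(\<lambda>n. \<phi> n m) \<longlonglongrightarrow> indicator F m" for m
    proof (cases "m \<in> F")
      case True thus ?thesis unfolding \<phi>_def by simp
    next
      case False
      hence pos: "0 < infdist m F" using in_closed_iff_infdist_zero[OF F \<open>F \<noteq> {}\<close>] infdist_nonneg[of m F] by fastforce
      obtain n0 where n0: "1 < real n0 * infdist m F" using reals_Archimedean3[OF pos] by blast
      have "\<phi> n m = 0" if "n0 \<le> n" for n
      proof -
        have "real n0 * infdist m F \<le> real n * infdist m F" using that pos by simp
        thus ?thesis using n0 unfolding \<phi>_def by simp
      qed
      hence "\<forall>\<^sub>F n in sequentially. \<phi> n m = indicator F m" using False by (auto simp: eventually_sequentially)
      thus ?thesis by (rule tendsto_eventually)
    qed
    have "(\<lambda>n. flux \<rho> (\<phi> n)) \<longlonglongrightarrow> N F"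
      unfolding flux_h N_h
    proof (rule integral_dominated_convergence[where w="\<lambda>x. norm (h x)"])
      have "(\<lambda>x. h x * \<psi> (dir \<rho> x)) \<in> borel_measurable surface_measure" if "continuous_on K' \<psi>" for \<psi>
      proof -
        have "(\<lambda>x. indicator K x *\<^sub>R (f x * (weight \<rho> x * \<psi> (dir \<rho> x)))) \<in> borel_measurable surface_measure"
          using flux_integrable[OF adm lo that] unfolding set_integrable_def by auto
        thus ?thesis unfolding h_def by (simp add: mult_ac)
      qed
      thus "(\<lambda>x. h x * \<phi> n (dir \<rho> x)) \<in> borel_measurable surface_measure" for n using \<phi>c by blast
      have "(\<lambda>x. indicator {x \<in> K. dir \<rho> x \<in> F} x *\<^sub>R (f x * weight \<rho> x)) \<in> borel_measurable surface_measure"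
        using wi[OF borel_closed[OF F]] unfolding set_integrable_def by auto
      moreover have "indicator {x \<in> K. dir \<rho> x \<in> F} x *\<^sub>R (f x * weight \<rho> x) = h x * indicator F (dir \<rho> x)" for x
        unfolding h_def by (simp add: indicator_def)
      ultimately show "(\<lambda>x. h x * indicator F (dir \<rho> x)) \<in> borel_measurable surface_measure" by (simp only:)
      show "AE x in surface_measure. (\<lambda>n. h x * \<phi> n (dir \<rho> x)) \<longlonglongrightarrow> h x * indicator F (dir \<rho> x)"
        by (intro always_eventually allI tendsto_intros \<phi>lim)
      show "AE x in surface_measure. norm (h x * \<phi> n (dir \<rho> x)) \<le> norm (h x)" for n
        using \<phi>01 by (intro always_eventually allI) (simp add: abs_mult mult_left_le)
    qed (use h in simp)
    moreover have "(\<lambda>n. LINT m|\<eta>. \<phi> n m) \<longlonglongrightarrow> (LINT m|\<eta>. indicator (F \<inter> K') m)"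
    proof (rule integral_dominated_convergence[where w="\<lambda>_. 1"])
      show "(indicator (F \<inter> K') :: _ \<Rightarrow> real) \<in> borel_measurable \<eta>"
        using sets_Int[OF borel_closed[OF F]] by (intro borel_measurable_indicator)
      show "\<phi> n \<in> borel_measurable \<eta>" for n by (rule borel_measurable_continuous_on_K'[OF sets_\<eta> \<phi>c])
      show "AE m in \<eta>. (\<lambda>n. \<phi> n m) \<longlonglongrightarrow> indicator (F \<inter> K') m"
      proof (rule AE_I2)
        fix m assume "m \<in> space \<eta>"
        thus "(\<lambda>n. \<phi> n m) \<longlonglongrightarrow> indicator (F \<inter> K') m" using \<phi>lim[of m] by (simp add: indicator_def space_\<eta>)
      qed
      show "AE m in \<eta>. norm (\<phi> n m) \<le> 1" for n using \<phi>01 by simp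
    qed simp
    hence "(\<lambda>n. (LINT m|\<eta>. \<phi> n m) + c * \<phi> n m0) \<longlonglongrightarrow> measure \<eta> (F \<inter> K') + c * indicator F m0"
      using sets_Int[OF borel_closed[OF F]]
      by (intro tendsto_intros \<phi>lim) (simp add: space_\<eta> Int_assoc)
    hence "(\<lambda>n. flux \<rho> (\<phi> n)) \<longlonglongrightarrow> measure \<eta> (F \<inter> K') + c * indicator F m0"
      by (simp only: tested[OF \<phi>c])
    ultimately show ?thesis by (rule LIMSEQ_unique)
  qed
  have "Int_stable (Collect (closed :: (real^3) set \<Rightarrow> bool))" by (auto simp: Int_stable_def)
  moreover have "Collect (closed :: (real^3) set \<Rightarrow> bool) \<subseteq> Pow UNIV" by simp
  moreover have "E \<in> sigma_sets UNIV (Collect closed)" using E by (simp add: borel_eq_closed)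
  ultimately have "N E = measure \<eta> (E \<inter> K') + c * indicator E m0"
  proof (induction E rule: sigma_sets_induct_disjoint)
    case (basic F) thus ?case using closed by simp
  next
    case empty show ?case unfolding N_h by simp
  next
    case (compl A)
    have A: "A \<in> sets borel" using compl by (simp add: borel_eq_closed)
    have "N A + N (UNIV - A) = N UNIV"
    proof -
      have "{x \<in> K. dir \<rho> x \<in> UNIV} = {x \<in> K. dir \<rho> x \<in> A} \<union> {x \<in> K. dir \<rho> x \<in> UNIV - A}" by auto
      moreover have "UNIV - A \<in> sets borel" using A by auto
      moreover have "{x \<in> K. dir \<rho> x \<in> A} \<inter> {x \<in> K. dir \<rho> x \<in> UNIV - A} = {}" by auto
      ultimately show ?thesis unfolding N_def
        using set_integral_Un[OF _ wi[OF A] wi, of "UNIV - A"] by (simp only:)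
    qed
    moreover have "measure \<eta> ((UNIV - A) \<inter> K') = measure \<eta> K' - measure \<eta> (A \<inter> K')"
    proof -
      have "(UNIV - A) \<inter> K' = space \<eta> - A \<inter> K'" using space_\<eta> by auto
      thus ?thesis using \<eta>.finite_measure_compl[OF sets_Int[OF A]] by (simp add: space_\<eta>)
    qed
    ultimately show ?case using compl N_UNIV by (auto simp: indicator_def)
  next
    case (union A)
    have A: "A i \<in> sets borel" for i using union by (auto simp: borel_eq_closed)
    have disj: "A i \<inter> A j = {}" if "i \<noteq> j" for i j using union(1) that by (auto simp: disjoint_family_on_def)
    have UnA: "(\<Union>i. A i) \<in> sets borel" using A by auto
    have eq: "{x \<in> K. dir \<rho> x \<in> (\<Union>i. A i)} = (\<Union>i. {x \<in> K. dir \<rho> x \<in> A i})" by auto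
    have "N (\<Union>i. A i) = (\<Sum>i. N (A i))"
      unfolding N_def eq
    proof (rule lebesgue_integral_countable_add)
      show "{x \<in> K. dir \<rho> x \<in> A i} \<in> sets surface_measure" for i by (rule dir_vimage_sets[OF adm lo A])
      show "{x \<in> K. dir \<rho> x \<in> A i} \<inter> {x \<in> K. dir \<rho> x \<in> A j} = {}" if "i \<noteq> j" for i j using disj[OF that] by auto
      show "set_integrable surface_measure (\<Union>i. {x \<in> K. dir \<rho> x \<in> A i}) (\<lambda>x. f x * weight \<rho> x)"
        using wi[OF UnA] unfolding eq .
    qed
    also have "(\<lambda>i. measure \<eta> (A i \<inter> K') + c * indicator (A i) m0) sums
      (measure \<eta> (\<Union>i. A i \<inter> K') + c * indicator (\<Union>i. A i) m0)"
    proof (intro sums_add sums_mult)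
      show "(\<lambda>i. measure \<eta> (A i \<inter> K')) sums measure \<eta> (\<Union>i. A i \<inter> K')"
      proof (rule \<eta>.finite_measure_UNION)
        show "range (\<lambda>i. A i \<inter> K') \<subseteq> sets \<eta>" using sets_Int A by auto
        show "disjoint_family (\<lambda>i. A i \<inter> K')" using disj unfolding disjoint_family_on_def by blast
      qed
      show "(\<lambda>i. indicator (A i) m0 :: real) sums indicator (\<Union>i. A i) m0" by (rule indicator_sums[OF disj])
    qed
    hence "(\<Sum>i. N (A i)) = measure \<eta> (\<Union>i. A i \<inter> K') + c * indicator (\<Union>i. A i) m0"
      unfolding union(3) by (rule sums_unique[symmetric])
    finally show ?case by (simp add: Int_UN_distrib2)
  qed
  thus ?thesis unfolding N_def .
qed

end

section \<open>The outer normal\<close>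

text \<open>A derivative within a piece of the sphere is not determined as a linear map on the whole
  space, only along tangent vectors. Near x the great circle with velocity h stays in K, and the
  chain rule along it reduces the claim to uniqueness of derivatives in one real variable.\<close>

lemma has_derivative_sphere_tangent_unique:
  fixes \<Phi> :: "'a::real_inner \<Rightarrow> 'b::real_normed_vector"
  assumes D: "(\<Phi> has_derivative D) (at x within K)" and D': "(\<Phi> has_derivative D') (at x within K)"
    and V: "open V" "x \<in> V" "V \<inter> sphere 0 1 \<subseteq> K" and x: "norm x = 1" and h: "h \<bullet> x = 0"
  shows "D h = D' h"
proof -
  have unit: "D h = D' h" if h: "h \<bullet> x = 0" "norm h = 1" for h
  proof -
    define c where "c t = cos t *\<^sub>R x + sin t *\<^sub>R h" for t
    have c0: "c 0 = x" unfolding c_def by simp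
    have "isCont c 0" unfolding c_def by (intro continuous_intros)
    from this[unfolded continuous_at_open, rule_format, of V]
    obtain T where T: "open T" "0 \<in> T" "\<And>t. t \<in> T \<Longrightarrow> c t \<in> V" using V c0 by auto
    have c_sphere: "norm (c t) = 1" for t
    proof -
      have "(norm (c t))\<^sup>2 = (cos t)\<^sup>2 * (x \<bullet> x) + (sin t)\<^sup>2 * (h \<bullet> h) + 2 * (cos t * sin t) * (h \<bullet> x)"
        unfolding power2_norm_eq_inner c_def
        by (simp add: inner_add_left inner_add_right inner_commute power2_eq_square algebra_simps)
      hence "(norm (c t))\<^sup>2 = 1" using h x by (simp add: dot_square_norm)
      thus ?thesis by (simp add: power2_eq_1_iff) (use norm_ge_zero[of "c t"] in linarith)
    qed
    have cT: "c ` T \<subseteq> K" using T(3) c_sphere V(3) by auto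
    have cd: "(c has_derivative (\<lambda>t. t *\<^sub>R h)) (at 0 within T)"
      unfolding c_def by (auto intro!: derivative_eq_intros)
    have *: "((\<Phi> \<circ> c) has_derivative (\<lambda>t. E (t *\<^sub>R h))) (at 0)" if "(\<Phi> has_derivative E) (at x within K)" for E
      using diff_chain_within[OF cd, of \<Phi> E] has_derivative_subset[OF that cT] c0 at_within_open[OF T(2,1)]
      by (simp add: o_def)
    have "(\<lambda>t. D (t *\<^sub>R h)) = (\<lambda>t. D' (t *\<^sub>R h))" by (rule has_derivative_unique[OF *[OF D] *[OF D']])
    from fun_cong[OF this, of 1] show ?thesis by simp
  qed
  show ?thesis
  proof (cases "h = 0")
    case True
    thus ?thesis using D D' by (simp add: linear_simps has_derivative_bounded_linear)
  next
    case False
    have "D (h /\<^sub>R norm h) = D' (h /\<^sub>R norm h)" using h False by (intro unit) auto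
    moreover have "linear D" "linear D'" using D D' has_derivative_linear by blast+
    ultimately show ?thesis using False by (simp add: linear_scale)
  qed
qed

text \<open>Altering a function on a null set changes preimages by subsets of null sets. This serves
  for the density, whose normal may be unspecified at exceptional points.\<close>

lemma (in complete_measure) borel_measurable_cong_AE_complete:
  fixes f g :: "'a \<Rightarrow> 'b::topological_space"
  assumes g: "g \<in> borel_measurable M" and eq: "AE x in M. f x = g x"
  shows "f \<in> borel_measurable M"
proof (rule measurableI)
  fix A :: "'b set" assume A: "A \<in> sets borel"
  let ?N = "{x \<in> space M. f x \<noteq> g x}"
  have N: "?N \<in> null_sets M" using eq AE_iff_null_sets[of "\<lambda>x. f x = g x"] by simp
  have "f -` A \<inter> space M = (g -` A \<inter> space M - ?N) \<union> (f -` A \<inter> ?N)" by auto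
  moreover have "f -` A \<inter> ?N \<in> null_sets M" by (rule complete2[OF _ N]) auto
  ultimately show "f -` A \<inter> space M \<in> sets M"
    using sets.Un[OF sets.Diff[OF measurable_sets[OF g A] null_setsD2[OF N]] null_setsD2] by (simp only:)
qed auto

section \<open>Supporting paraboloids, the derivative of the radial function and the normal\<close>

context separated_directions
begin

lemma touches_iff_supports:
  assumes "closure \<Omega> = K" "x \<in> K" "m \<in> K'" "0 < \<rho> x"
  shows "touches K \<rho> m x \<longleftrightarrow> supports \<Omega> \<rho> (\<rho> x * (1 - x \<bullet> m)) m x"
proof -
  have pos: "0 < 1 - y \<bullet> m" if "y \<in> K" for y using one_minus_ge[OF that assms(3)] \<delta>_pos by simp
  show ?thesis
    unfolding touches_def supports_def polar_radius_def assms(1) using pos[OF assms(2)] assms(4)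
    by (auto simp: pos_le_divide_eq[OF pos])
qed

lemma supports_imp_touches:
  assumes "closure \<Omega> = K" "x \<in> K" "m \<in> K'" "supports \<Omega> \<rho> d m x"
  shows "touches K \<rho> m x"
proof -
  have pos: "0 < 1 - y \<bullet> m" if "y \<in> K" for y using one_minus_ge[OF that assms(3)] \<delta>_pos by simp
  have "\<rho> x * (1 - x \<bullet> m) = d" using assms(4) pos[OF assms(2)] unfolding supports_def polar_radius_def by simp
  thus ?thesis using assms(4) unfolding touches_def supports_def polar_radius_def assms(1)
    by (auto simp: pos_le_divide_eq[OF pos])
qed

text \<open>On K, 1 / \<rho> is a supremum of affine functions coming from the touching paraboloids.
  Those touching at x and at y bound the remainder between 0 and (x - y) \<bullet> (F y - F x), so
  continuity at x of the selection F, whose negative gives the slopes, yields differentiability. The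
  selection may jump elsewhere: uniqueness of the direction enters at x alone.\<close>

lemma has_derivative_inverse_radius:
  assumes adm: "admissible lo hi \<rho>" and lo: "0 < lo" and x: "x \<in> K" "single_dir \<rho> x"
  shows "((\<lambda>y. 1 / \<rho> y) has_derivative (\<lambda>h. - (h \<bullet> dir \<rho> x) / (\<rho> x * (1 - x \<bullet> dir \<rho> x)))) (at x within K)"
proof -
  have \<rho>: "0 < \<rho> y" if "y \<in> K" for y using adm lo that unfolding admissible_def by (smt (verit))
  define D where "D y = \<rho> y * (1 - y \<bullet> dir \<rho> y)" for y
  define F where "F y = dir \<rho> y /\<^sub>R D y" for y
  have pos: "0 < 1 - z \<bullet> dir \<rho> y" if "y \<in> K" "z \<in> K" for y z
    using one_minus_ge[OF that(2) dir_props(1)[OF adm that(1)]] \<delta>_pos by simp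
  have D: "0 < D y" if "y \<in> K" for y using \<rho> pos that unfolding D_def by simp
  have touch: "(1 - z \<bullet> dir \<rho> y) / D y \<le> 1 / \<rho> z" if "y \<in> K" "z \<in> K" for y z
    using dir_props(2)[OF adm that(1)] that(2) \<rho>[OF that(2)] D[OF that(1)]
    unfolding touches_def D_def by (simp add: field_simps)
  have eq: "1 / \<rho> y = (1 - y \<bullet> dir \<rho> y) / D y" if "y \<in> K" for y
    using \<rho>[OF that] pos[OF that that] unfolding D_def by simp
  have "continuous (at x within K) F"
    unfolding continuous_within_sequentially
  proof (intro allI impI, elim conjE)
    fix y assume y: "\<forall>n. y n \<in> K" "y \<longlonglongrightarrow> x"
    have \<rho>y: "(\<lambda>n. \<rho> (y n)) \<longlonglongrightarrow> \<rho> x"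
      using admissible_continuous[OF adm lo] y x unfolding continuous_on_sequentially o_def by auto
    have my: "(\<lambda>n. dir \<rho> (y n)) \<longlonglongrightarrow> dir \<rho> x"
      by (rule directions_converge[where x=y and l=x and \<rho>="\<rho>" and \<rho>s="\<lambda>_. \<rho>", OF _ \<rho>y])
        (use y x dir_props[OF adm] in auto)
    show "(F \<circ> y) \<longlonglongrightarrow> F x"
      unfolding F_def D_def o_def using D[OF x(1)] unfolding D_def
      by (intro tendsto_intros \<rho>y my y) auto
  qed
  hence F: "\<And>e. 0 < e \<Longrightarrow> \<exists>d>0. \<forall>y\<in>K. dist y x < d \<longrightarrow> dist (F y) (F x) < e"
    unfolding continuous_within_eps_delta by blast
  have bound: "\<bar>1 / \<rho> y - 1 / \<rho> x + (y - x) \<bullet> dir \<rho> x / D x\<bar> \<le> norm (F y - F x) * norm (y - x)" if y: "y \<in> K" for y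
  proof -
    let ?a = "1 / \<rho> y - 1 / \<rho> x + (y - x) \<bullet> dir \<rho> x / D x"
    have "0 \<le> ?a" using touch[OF x(1) y] unfolding eq[OF x(1)]
      by (simp add: inner_diff_left diff_divide_distrib)
    moreover have "?a \<le> (x - y) \<bullet> (F y - F x)" using touch[OF y x(1)] unfolding eq[OF y]
      by (simp add: F_def inner_diff_left inner_diff_right diff_divide_distrib divide_inverse algebra_simps)
    moreover have "\<dots> \<le> norm (x - y) * norm (F y - F x)" by (rule norm_cauchy_schwarz)
    ultimately show ?thesis by (simp add: norm_minus_commute mult.commute)
  qed
  show ?thesis
    unfolding has_derivative_within_alt
  proof (intro conjI allI impI)
    show "bounded_linear (\<lambda>h. - (h \<bullet> dir \<rho> x) / (\<rho> x * (1 - x \<bullet> dir \<rho> x)))"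
      using bounded_linear_inner_left[of "(- 1 / (\<rho> x * (1 - x \<bullet> dir \<rho> x))) *\<^sub>R dir \<rho> x"] by simp
    fix e :: real assume "0 < e"
    from F[OF this] obtain d where d: "0 < d" "\<And>y. y \<in> K \<Longrightarrow> dist y x < d \<Longrightarrow> dist (F y) (F x) < e" by blast
    show "\<exists>d>0. \<forall>y\<in>K. norm (y - x) < d \<longrightarrow>
      norm (1 / \<rho> y - 1 / \<rho> x - - ((y - x) \<bullet> dir \<rho> x) / (\<rho> x * (1 - x \<bullet> dir \<rho> x))) \<le> e * norm (y - x)"
    proof (intro exI[of _ d] conjI d(1) ballI impI)
      fix y assume y: "y \<in> K" "norm (y - x) < d"
      have "norm (F y - F x) * norm (y - x) \<le> e * norm (y - x)"
        using d(2)[OF y(1)] y(2) by (intro mult_right_mono) (auto simp: dist_norm)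
      thus "norm (1 / \<rho> y - 1 / \<rho> x - - ((y - x) \<bullet> dir \<rho> x) / (\<rho> x * (1 - x \<bullet> dir \<rho> x))) \<le> e * norm (y - x)"
        using bound[OF y(1)] unfolding D_def by simp
    qed
  qed
qed

text \<open>The derivative of \<rho>(y) y maps tangent vectors into the plane orthogonal to x - m.
  Uniqueness, which the definite description requires, rests on the fact that any derivative within
  K agrees with \<open>D0\<close> on tangent vectors when x is interior to K in the sphere.\<close>

lemma outer_normal_eq:
  assumes adm: "admissible lo hi \<rho>" and lo: "0 < lo" and x: "x \<in> K" "single_dir \<rho> x"
    and \<Omega>: "closure \<Omega> = K" and V: "open V" "x \<in> V" "V \<inter> S2 \<subseteq> K"
  shows "outer_normal \<Omega> \<rho> x = (x - dir \<rho> x) /\<^sub>R norm (x - dir \<rho> x)"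
proof -
  define m where "m = dir \<rho> x"
  have m: "m \<in> K'" unfolding m_def by (rule dir_props[OF adm x(1)])
  have \<rho>: "0 < \<rho> x" using adm lo x unfolding admissible_def by (smt (verit))
  have t: "0 < 1 - x \<bullet> m" using one_minus_ge[OF x(1) m] \<delta>_pos by simp
  have nx: "norm x = 1" "x \<bullet> x = 1" using norm_K[OF x(1)] by (auto simp: dot_square_norm)
  define D0 where "D0 h = \<rho> x *\<^sub>R h + (\<rho> x * (h \<bullet> m) / (1 - x \<bullet> m)) *\<^sub>R x" for h
  have D0: "((\<lambda>y. \<rho> y *\<^sub>R y) has_derivative D0) (at x within K)"
  proof -
    have "1 / \<rho> x \<noteq> 0" using \<rho> by simp
    note d = Deriv.has_derivative_inverse[OF this has_derivative_inverse_radius[OF adm lo x], folded m_def]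
    have "- (inverse (1 / a) * (- k / (a * t)) * inverse (1 / a)) = a * k / t" if "0 < a" "0 < t" for a k t :: real
      using that by (simp add: field_simps)
    from this[OF \<rho> t] have "((\<lambda>y. inverse (1 / \<rho> y)) has_derivative (\<lambda>h. \<rho> x * (h \<bullet> m) / (1 - x \<bullet> m))) (at x within K)"
      by (intro has_derivative_eq_rhs[OF d] ext)
    hence "(\<rho> has_derivative (\<lambda>h. \<rho> x * (h \<bullet> m) / (1 - x \<bullet> m))) (at x within K)" by simp
    from has_derivative_scaleR[OF this has_derivative_ident] show ?thesis unfolding D0_def by simp
  qed
  have D0_inner: "D0 h \<bullet> \<nu> = \<rho> x * (h \<bullet> \<nu> + (h \<bullet> m) * ((x \<bullet> \<nu>) / (1 - x \<bullet> m)))" for h \<nu>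
    unfolding D0_def by (simp add: inner_add_left algebra_simps)
  have xm: "x \<bullet> (x - m) = 1 - x \<bullet> m" using nx by (simp add: inner_diff_right)
  hence ne: "x - m \<noteq> 0" using t by auto
  have "outer_normal \<Omega> \<rho> x = (x - m) /\<^sub>R norm (x - m)"
    unfolding outer_normal_def \<Omega>
  proof (rule the_equality)
    show "norm ((x - m) /\<^sub>R norm (x - m)) = 1 \<and> 0 < x \<bullet> ((x - m) /\<^sub>R norm (x - m)) \<and>
      (\<exists>D. ((\<lambda>y. \<rho> y *\<^sub>R y) has_derivative D) (at x within K) \<and>
        (\<forall>h. h \<bullet> x = 0 \<longrightarrow> D h \<bullet> ((x - m) /\<^sub>R norm (x - m)) = 0))"
    proof (intro conjI exI[of _ D0] D0 allI impI)
      show "norm ((x - m) /\<^sub>R norm (x - m)) = 1" using ne by simp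
      show "0 < x \<bullet> ((x - m) /\<^sub>R norm (x - m))" using ne xm t by simp
      fix h assume h: "h \<bullet> x = 0"
      have "D0 h \<bullet> (x - m) = 0" unfolding D0_inner xm using h t by (simp add: inner_diff_right)
      thus "D0 h \<bullet> ((x - m) /\<^sub>R norm (x - m)) = 0" by simp
    qed
  next
    fix \<nu> assume \<nu>: "norm \<nu> = 1 \<and> 0 < x \<bullet> \<nu> \<and>
      (\<exists>D. ((\<lambda>y. \<rho> y *\<^sub>R y) has_derivative D) (at x within K) \<and> (\<forall>h. h \<bullet> x = 0 \<longrightarrow> D h \<bullet> \<nu> = 0))"
    then obtain D where D: "((\<lambda>y. \<rho> y *\<^sub>R y) has_derivative D) (at x within K)" "\<And>h. h \<bullet> x = 0 \<Longrightarrow> D h \<bullet> \<nu> = 0" by blast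
    define s where "s = (x \<bullet> \<nu>) / (1 - x \<bullet> m)"
    have s: "0 < s" using \<nu> t unfolding s_def by simp
    \<comment> \<open>The factor s makes w tangent at x. Orthogonality of \<nu> to the image of w
      then reads w \<bullet> w = 0.\<close>
    define w where "w = \<nu> - s *\<^sub>R (x - m)"
    have "x \<bullet> w = x \<bullet> \<nu> - s * (x \<bullet> (x - m))"
      unfolding w_def by (simp only: inner_diff_right[of x \<nu>] inner_scaleR_right)
    hence wx: "w \<bullet> x = 0" unfolding xm s_def using t by (simp add: inner_commute)
    have "D0 w \<bullet> \<nu> = 0"
      using D(2)[OF wx] has_derivative_sphere_tangent_unique[OF D(1) D0 V nx(1) wx] by simp
    hence "w \<bullet> \<nu> + (w \<bullet> m) * s = 0" unfolding D0_inner s_def using \<rho> by simp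
    hence "w \<bullet> w = 0" using wx by (subst (2) w_def) (simp add: inner_diff_right algebra_simps)
    hence \<nu>eq: "\<nu> = s *\<^sub>R (x - m)" unfolding w_def by simp
    hence "s * norm (x - m) = 1" using \<nu> s by simp
    hence "s = inverse (norm (x - m))" using ne by (simp add: field_simps)
    thus "\<nu> = (x - m) /\<^sub>R norm (x - m)" using \<nu>eq by simp
  qed
  thus ?thesis unfolding m_def .
qed

end

lemma (in flux_setup) refl_density_eq:
  assumes adm: "admissible lo hi \<rho>" and lo: "0 < lo" and x: "x \<in> K" "single_dir \<rho> x"
    and \<Omega>: "closure \<Omega> = K" and V: "open V" "x \<in> V" "V \<inter> S2 \<subseteq> K"
  shows "refl_density \<Omega> f \<rho> x = f x * weight \<rho> x"
proof -
  define m where "m = dir \<rho> x"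
  have m: "m \<in> K'" unfolding m_def by (rule dir_props[OF adm x(1)])
  define t where "t = 1 - x \<bullet> m"
  have t: "0 < t" using one_minus_ge[OF x(1) m] \<delta>_pos unfolding t_def by simp
  have n: "x \<bullet> x = 1" "m \<bullet> m = 1" using norm_K[OF x(1)] norm_K'[OF m] by (auto simp: dot_square_norm)
  have "norm (x - m) = sqrt (2 * t)"
    unfolding norm_eq_sqrt_inner t_def using n by (simp add: inner_diff_left inner_diff_right inner_commute)
  moreover have "x \<bullet> (x - m) = t" unfolding t_def using n by (simp add: inner_diff_right)
  ultimately have "x \<bullet> outer_normal \<Omega> \<rho> x = t / sqrt (2 * t)"
    unfolding outer_normal_eq[OF assms] m_def[symmetric] by (simp add: divide_inverse mult.commute)
  also have "\<dots> = sqrt (t / 2)"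
  proof -
    have "sqrt (t / 2) * sqrt (2 * t) = sqrt (t\<^sup>2)" by (subst real_sqrt_mult[symmetric]) (simp add: power2_eq_square)
    thus ?thesis using t by (simp add: field_simps del: real_sqrt_mult)
  qed
  finally show ?thesis unfolding refl_density_def weight_def m_def[symmetric] t_def by simp
qed

section \<open>Assembly for the closures of \<Omega> and \<Omega>'\<close>

theorem theorem7p14:
  fixes \<Omega> \<Omega>' :: "(real^3) set" and f :: "real^3 \<Rightarrow> real" and \<eta> :: "(real^3) measure"
    and \<delta> a a' :: real
  assumes "\<Omega> \<subseteq> S2" and "\<Omega>' \<subseteq> S2"
    and "top_of_set S2 frontier_of \<Omega> \<in> null_sets surface_measure"
    and "0 < \<delta>" and "\<delta> < 1"
    and "\<forall>x\<in>closure \<Omega>. \<forall>m\<in>closure \<Omega>'. x \<bullet> m \<le> 1 - \<delta>"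
    and "set_integrable surface_measure (closure \<Omega>) f"
    and "AE x in surface_measure. x \<in> closure \<Omega> \<longrightarrow> f x > 0"
    and "radon_measure_on (closure \<Omega>') \<eta>"
    and "a > 0" and "a' \<ge> 4 * a / \<delta>"
    and "(LINT x:closure \<Omega>|surface_measure. f x) \<ge> 1 / C_const a' \<delta> * measure \<eta> (closure \<Omega>')"
  shows "\<forall>m\<^sub>0\<in>support_on (closure \<Omega>') \<eta>. \<exists>\<rho>.
    reflector \<Omega> \<Omega>' \<rho> \<and>
    (\<forall>E. E \<in> sets borel \<and> E \<subseteq> closure \<Omega>' \<longrightarrow>
       set_integrable surface_measure (tau_set \<Omega> \<rho> E) (refl_density \<Omega> f \<rho>) \<and>
       measure \<eta> E \<le> (LINT x:tau_set \<Omega> \<rho> E|surface_measure. refl_density \<Omega> f \<rho> x)) \<and>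
    (\<forall>E. E \<in> sets borel \<and> E \<subseteq> closure \<Omega>' \<and> m\<^sub>0 \<notin> E \<longrightarrow>
       measure \<eta> E = (LINT x:tau_set \<Omega> \<rho> E|surface_measure. refl_density \<Omega> f \<rho> x)) \<and>
    \<rho> \<in> reflector_class \<Omega> \<Omega>' a \<and>
    (\<forall>x\<in>closure \<Omega>. a \<le> \<rho> x \<and> \<rho> x \<le> a' / \<delta>)"
proof
  fix m0 assume m0: "m0 \<in> support_on (closure \<Omega>') \<eta>"
  define K where "K = closure \<Omega>"
  define K' where "K' = closure \<Omega>'"
  have KS: "K \<subseteq> S2" "K' \<subseteq> S2" unfolding K_def K'_def using assms(1,2) by (simp_all only: closure_minimal closed_sphere)
  interpret flux_setup K K' \<delta> f
  proof unfold_locales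
    show "compact K" "compact K'"
      using KS bounded_subset[OF bounded_sphere] unfolding K_def K'_def by (auto simp: compact_eq_bounded_closed)
    show "AE x in surface_measure. x \<in> K \<longrightarrow> 0 \<le> f x"
      using assms(8) unfolding K_def by eventually_elim auto
  qed (use KS assms in \<open>auto simp: K_def K'_def\<close>)
  interpret complete_measure surface_measure by (rule complete_surface_measure)
  have sets_\<eta>: "sets \<eta> = sets (restrict_space borel K')"
    and compact_\<eta>: "\<And>C. compact C \<Longrightarrow> C \<subseteq> K' \<Longrightarrow> emeasure \<eta> C < \<infinity>"
    using assms(9) unfolding radon_measure_on_def K'_def by auto
  have space_\<eta>: "space \<eta> = K'" using sets_eq_imp_space_eq[OF sets_\<eta>] by (simp add: space_restrict_space)
  have fin_\<eta>: "finite_measure \<eta>"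
    using compact_\<eta>[OF compact_K'] by (intro finite_measureI) (simp add: space_\<eta>)
  interpret \<eta>: finite_measure \<eta> by (rule fin_\<eta>)
  have m0K: "m0 \<in> K'" using m0 unfolding support_on_def K'_def by simp
  have supp: "0 < measure \<eta> (ball m0 e \<inter> K')" if "0 < e" for e
  proof -
    have "openin (top_of_set K') (ball m0 e \<inter> K')" by (simp add: Int_commute openin_open_Int)
    hence "0 < emeasure \<eta> (ball m0 e \<inter> K')"
      using m0 m0K that unfolding support_on_def K'_def[symmetric] by simp
    thus ?thesis by (simp add: \<eta>.emeasure_eq_measure)
  qed
  have a': "0 < a'"
  proof -
    have "0 < 4 * a / \<delta>" using assms(4,10) by simp
    thus ?thesis using assms(11) by linarith
  qed
  \<comment> \<open>Through this inequality the bounds \<delta> * a' / 2 on parameters and \<delta>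
    * a' / 4 on radii become 2 * a and a.\<close>
  have aa': "4 * a \<le> \<delta> * a'" using assms(4,11) by (simp add: field_simps)
  have total: "measure \<eta> K' \<le> \<delta>^3 / (2 * a'\<^sup>2) * (LINT x:K|surface_measure. f x)"
  proof -
    have "0 < \<delta>^3 / (2 * a'\<^sup>2)" using assms(4) a' by simp
    moreover have "m \<le> C * I" if "0 < C" "1 / C * m \<le> I" for C m I :: real
      using that by (simp add: pos_divide_le_eq mult.commute)
    ultimately show ?thesis using assms(12) unfolding C_const_def K_def K'_def by blast
  qed
  define lo where "lo = \<delta> * a' / 4"
  have lo: "0 < lo" unfolding lo_def using assms(4) a' by simp
  obtain \<rho> c where adm: "admissible lo (a' / \<delta>) \<rho>" and c: "0 \<le> c"
    and touch: "\<forall>x\<in>K. \<exists>m\<in>K'. touches K \<rho> m x \<and> \<delta> * a' / 2 \<le> \<rho> x * (1 - x \<bullet> m)"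
    and tested: "\<forall>\<phi>. continuous_on K' \<phi> \<longrightarrow> flux \<rho> \<phi> = (LINT m|\<eta>. \<phi> m) + c * \<phi> m0"
    using reflector_exists_test_functions[OF sets_\<eta> fin_\<eta> m0K supp _ a' total] assms(5) unfolding lo_def by auto
  have \<rho>: "0 < \<rho> x" "lo \<le> \<rho> x" "\<rho> x \<le> a' / \<delta>" if "x \<in> K" for x
    using adm lo that unfolding admissible_def by (auto intro: less_le_trans)
  have in_class: "\<exists>m\<in>K'. \<exists>d\<ge>2 * a. supports \<Omega> \<rho> d m x" if x: "x \<in> K" for x
  proof -
    obtain m where m: "m \<in> K'" "touches K \<rho> m x" "\<delta> * a' / 2 \<le> \<rho> x * (1 - x \<bullet> m)" using touch x by blast
    have "supports \<Omega> \<rho> (\<rho> x * (1 - x \<bullet> m)) m x"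
      using touches_iff_supports[where \<rho>=\<rho>, OF K_def[symmetric] x m(1) \<rho>(1)[OF x]] m(2) by simp
    thus ?thesis using m(1,3) aa' by (intro bexI[of _ m] exI[of _ "\<rho> x * (1 - x \<bullet> m)"]) auto
  qed
  have reflector: "reflector \<Omega> \<Omega>' \<rho>"
    unfolding reflector_def K_def[symmetric] K'_def[symmetric] using \<rho>(1) in_class by blast
  let ?N = "{x \<in> K. \<not> single_dir \<rho> x}"
  have N: "?N \<in> null_sets surface_measure" by (rule null_set_not_single_dir[OF adm lo])
  \<comment> \<open>As the frontier is null, almost every point of K is interior to \<Omega> in the
    sphere; with a single touching direction the normal is then determined.\<close>
  have AE_density: "AE x in surface_measure. x \<in> K \<longrightarrow> refl_density \<Omega> f \<rho> x = f x * weight \<rho> x"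
    using AE_not_in[OF assms(3)] AE_single_dir[OF adm lo]
  proof eventually_elim
    case (elim x)
    show ?case
    proof
      assume x: "x \<in> K"
      have "x \<in> top_of_set S2 interior_of \<Omega>"
      proof (rule ccontr)
        assume "x \<notin> top_of_set S2 interior_of \<Omega>"
        moreover have "x \<in> top_of_set S2 closure_of \<Omega>"
          using x KS assms(1) unfolding K_def by (auto simp: closure_of_subtopology Int_absorb1)
        ultimately show False using elim unfolding frontier_of_def by simp
      qed
      then obtain T where T: "openin (top_of_set S2) T" "x \<in> T" "T \<subseteq> \<Omega>" unfolding interior_of_def by blast
      then obtain V where V: "open V" "T = S2 \<inter> V" unfolding openin_open by blast
      show "refl_density \<Omega> f \<rho> x = f x * weight \<rho> x"
        by (rule refl_density_eq[OF adm lo x _ K_def[symmetric] V(1)])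
          (use elim x T V closure_subset in \<open>auto simp: K_def\<close>)
    qed
  qed
  have tau: "set_integrable surface_measure (tau_set \<Omega> \<rho> E) (refl_density \<Omega> f \<rho>)"
      "(LINT x:tau_set \<Omega> \<rho> E|surface_measure. refl_density \<Omega> f \<rho> x) = measure \<eta> E + c * indicator E m0"
    if E: "E \<in> sets borel" "E \<subseteq> K'" for E
  proof -
    let ?A = "{x \<in> K. dir \<rho> x \<in> E}"
    have tauK: "tau_set \<Omega> \<rho> E \<subseteq> K" unfolding tau_set_def tau_def K_def by auto
    \<comment> \<open>Where the direction is unique, being touched by some direction in E means that
      the selected one is in E. Hence \<open>tau_set\<close> differs from the preimage of E under
      \<open>dir\<close> by a null set only.\<close>
    have iff: "x \<in> tau_set \<Omega> \<rho> E \<longleftrightarrow> x \<in> ?A" if x: "x \<in> K" "single_dir \<rho> x" for x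
    proof
      assume "x \<in> tau_set \<Omega> \<rho> E"
      then obtain m d where m: "m \<in> E" "supports \<Omega> \<rho> d m x" unfolding tau_set_def tau_def by blast
      have "touches K \<rho> m x" by (rule supports_imp_touches[OF K_def[symmetric] x(1) _ m(2)]) (use m E in auto)
      hence "dir \<rho> x = m" using dir_eqI[OF adm x] m E by blast
      thus "x \<in> ?A" using m x by simp
    next
      assume "x \<in> ?A"
      hence "dir \<rho> x \<in> E" by simp
      moreover have "supports \<Omega> \<rho> (\<rho> x * (1 - x \<bullet> dir \<rho> x)) (dir \<rho> x) x"
        using touches_iff_supports[where \<rho>=\<rho>, OF K_def[symmetric] x(1) dir_props(1)[OF adm x(1)] \<rho>(1)[OF x(1)]]
          dir_props(2)[OF adm x(1)] by simp
      ultimately show "x \<in> tau_set \<Omega> \<rho> E" using x unfolding tau_set_def tau_def K_def by blast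
    qed
    have AE_eq: "AE x in surface_measure. indicator (tau_set \<Omega> \<rho> E) x *\<^sub>R refl_density \<Omega> f \<rho> x
        = indicator ?A x *\<^sub>R (f x * weight \<rho> x)"
      using AE_density AE_single_dir[OF adm lo]
    proof eventually_elim
      case (elim x)
      show ?case
      proof (cases "x \<in> K")
        case True thus ?thesis using iff[OF True] elim by (simp add: indicator_def)
      next
        case False thus ?thesis using tauK by (auto simp: indicator_def)
      qed
    qed
    have int: "integrable surface_measure (\<lambda>x. indicator ?A x *\<^sub>R (f x * weight \<rho> x))"
      using weighted_integrable[OF adm lo E(1)] unfolding set_integrable_def .
    have meas: "(\<lambda>x. indicator (tau_set \<Omega> \<rho> E) x *\<^sub>R refl_density \<Omega> f \<rho> x) \<in> borel_measurable surface_measure"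
      by (rule borel_measurable_cong_AE_complete[OF borel_measurable_integrable[OF int] AE_eq])
    show "set_integrable surface_measure (tau_set \<Omega> \<rho> E) (refl_density \<Omega> f \<rho>)"
      unfolding set_integrable_def
      using integrable_cong_AE[OF meas borel_measurable_integrable[OF int] AE_eq] int by simp
    have "(LINT x:tau_set \<Omega> \<rho> E|surface_measure. refl_density \<Omega> f \<rho> x) = (LINT x:?A|surface_measure. f x * weight \<rho> x)"
      unfolding set_lebesgue_integral_def
      by (rule integral_cong_AE[OF meas borel_measurable_integrable[OF int] AE_eq])
    also have "\<dots> = measure \<eta> (E \<inter> K') + c * indicator E m0"
      by (rule flux_measure_eq[OF adm lo sets_\<eta> fin_\<eta> _ E(1)]) (use tested in blast)
    also have "E \<inter> K' = E" using E by blast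
    finally show "(LINT x:tau_set \<Omega> \<rho> E|surface_measure. refl_density \<Omega> f \<rho> x) = measure \<eta> E + c * indicator E m0" .
  qed
  show "\<exists>\<rho>. reflector \<Omega> \<Omega>' \<rho> \<and>
    (\<forall>E. E \<in> sets borel \<and> E \<subseteq> closure \<Omega>' \<longrightarrow>
       set_integrable surface_measure (tau_set \<Omega> \<rho> E) (refl_density \<Omega> f \<rho>) \<and>
       measure \<eta> E \<le> (LINT x:tau_set \<Omega> \<rho> E|surface_measure. refl_density \<Omega> f \<rho> x)) \<and>
    (\<forall>E. E \<in> sets borel \<and> E \<subseteq> closure \<Omega>' \<and> m0 \<notin> E \<longrightarrow>
       measure \<eta> E = (LINT x:tau_set \<Omega> \<rho> E|surface_measure. refl_density \<Omega> f \<rho> x)) \<and>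
    \<rho> \<in> reflector_class \<Omega> \<Omega>' a \<and>
    (\<forall>x\<in>closure \<Omega>. a \<le> \<rho> x \<and> \<rho> x \<le> a' / \<delta>)"
    unfolding K'_def[symmetric] K_def[symmetric]
  proof (intro exI[of _ \<rho>] conjI allI impI ballI; (elim conjE)?)
    show "reflector \<Omega> \<Omega>' \<rho>" by (rule reflector)
    show "\<rho> \<in> reflector_class \<Omega> \<Omega>' a"
      unfolding reflector_class_def K_def[symmetric] K'_def[symmetric] using reflector in_class by blast
    show "a \<le> \<rho> x" "\<rho> x \<le> a' / \<delta>" if "x \<in> K" for x using \<rho>[OF that] aa' unfolding lo_def by auto
    fix E assume E: "E \<in> sets borel" "E \<subseteq> K'"
    show "set_integrable surface_measure (tau_set \<Omega> \<rho> E) (refl_density \<Omega> f \<rho>)" by (rule tau(1)[OF E])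
    \<comment> \<open>The surplus c is nonnegative and counts only if m0 lies in E: inequality in
      general, equality when m0 is outside E.\<close>
    show "measure \<eta> E \<le> (LINT x:tau_set \<Omega> \<rho> E|surface_measure. refl_density \<Omega> f \<rho> x)"
      unfolding tau(2)[OF E] using c by simp
    show "measure \<eta> E = (LINT x:tau_set \<Omega> \<rho> E|surface_measure. refl_density \<Omega> f \<rho> x)" if "m0 \<notin> E"
      unfolding tau(2)[OF E] using that by simp
  qed
qed

end
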